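(* For any integer $k\ge1$ and any $p\in[1/2,1]$ there exists a coupling of $T_k$ and $T_\infty(p)$ (that is, random trees $T_k\sim\mathcal{T}_k$ and $T_\infty(p)\sim\mathcal{T}_\infty(p)$ defined on a common probability space) such that $$\mathbb{P}\big(T_k\subset T_\infty(p)\big)=1.$$
   Context: Vertices and trees. Let $o$ be the root, $\mathcal{V}_0=\{o\}$, $\mathcal{V}_n=\{1,2,\ldots\}^n$ for $n\ge1$, and $\mathcal{V}=\bigcup_{n\ge0}\mathcal{V}_n$. For $v=(v_1,\ldots,v_n)\in\mathcal{V}_n$, $n\ge1$, the parent is $v^-=(v_1,\ldots,v_{n-1})$ (with $v^-=o$ if $n=1$); if $v_n\ge2$ put $v'=(v_1,\ldots,v_{n-1},v_n-1)$, otherwise $v'$ is undefined. For $v\in\mathcal V$ and $i\geq 1$, $(v,i)$ denotes $v$ with $i$ appended, with $(o,i)=(i)$. A set $V\subset\mathcal{V}$ induces the edges between $v$ and $v^-$ whenever $v,v^-\in V$; a tree $T$ is a connected graph with vertex set $V(T)\subset\mathcal{V}$ and the induced edges, so it is determined by $V(T)$. Write $|T|$ for the number of vertices. For trees $T,T'$, $T\subseteq T'$ (also written $T\subset T'$) means $V(T)\subseteq V(T')$. A random tree is regarded as a random element of $\{0,1\}^{\mathcal V}$ with the product $\sigma$-algebra. Uniform trees. $\mathcal{F}$ is the set of trees $T$ with $o\in V(T)$ such that $v\in V(T)$ implies $v'\in V(T)$ whenever $v'$ exists (rooted ordered trees). For $1\le k<\infty$, $\mathcal{T}_k$ is the uniform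 distribution on $\{T\in\mathcal{F}:|T|=k\}$. Geometric Galton-Watson tree. For $p\in(0,1)$ let $(X_v)_{v\in\mathcal{V}}$ be i.i.d. with $\mathbb{P}(X_v=k)=p^k(1-p)$, $k=0,1,\ldots$. Let $V_0(T(p))=\{o\}$, $V_{n+1}(T(p))=\bigcup_{v\in V_n(T(p))}\bigcup_{1\le i\le X_v}\{(v,i)\}$, and let $T(p)$ be the tree with vertex set $\bigcup_{n\ge0}V_n(T(p))$. For $p=1$, $X_v=\infty$ for all $v$, so $T(1)$ is the deterministic tree with vertex set $\mathcal{V}$. Infinite trees. For $p>1/2$, $\mathbb{P}(|T(p)|=\infty)>0$, and $\mathcal{T}_\infty(p)$ is the law of $T(p)$ conditioned on $|T(p)|=\infty$. For $p=1/2$, $\mathcal{T}_\infty(1/2)$ is the law of $T_\infty(1/2):=\bigcup_{k\ge1}T_k$, where $(T_k)_{k\ge1}$ is a coupling with $T_k\sim\mathcal{T}_k$ for every $k$ and $\mathbb{P}(T_1\subset T_2\subset\cdots)=1$; such a coupling exists by a theorem of Luczak and Winkler, and the law of the union does not depend on which such coupling is chosen. *)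

theory Defs
  imports "HOL-Probability.Probability"
begin

type_synonym vertex = "nat list"

text \<open>The root is \<^term>\<open>[]\<close>. For a vertex \<^term>\<open>v \<noteq> []\<close> the parent is \<^term>\<open>butlast v\<close>, and
  \<^term>\<open>v @ [i]\<close> is the child of \<^term>\<open>v\<close> with index \<^term>\<open>i\<close>; indices start at 1.\<close>

definition verts :: "vertex set" where
  "verts = {v. \<forall>i\<in>set v. 1 \<le> i}"

definition parent_edges :: "vertex set \<Rightarrow> (vertex \<times> vertex) set" where
  "parent_edges V = {(v, butlast v) | v. v \<noteq> [] \<and> v \<in> V \<and> butlast v \<in> V}"

text \<open>A tree is identified with its vertex set.\<close>

definition is_tree :: "vertex set \<Rightarrow> bool" where
  "is_tree T \<longleftrightarrow> T \<subseteq> verts \<and>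
     (\<forall>u\<in>T. \<forall>v\<in>T. (u, v) \<in> (parent_edges T \<union> (parent_edges T)\<inverse>)\<^sup>*)"

definition ordered_trees :: "vertex set set" where
  "ordered_trees = {T. is_tree T \<and> [] \<in> T \<and>
     (\<forall>v\<in>T. v \<noteq> [] \<and> last v \<ge> 2 \<longrightarrow> butlast v @ [last v - 1] \<in> T)}"

definition ordered_trees_of_size :: "nat \<Rightarrow> vertex set set" where
  "ordered_trees_of_size k = {T \<in> ordered_trees. finite T \<and> card T = k}"

text \<open>The product \<open>\<sigma>\<close>-algebra on \<open>{0,1}\<^sup>\<V>\<close>, transported to subsets of
  \<^term>\<open>verts\<close> along indicator functions.\<close>

definition tree_space :: "vertex set measure" where
  "tree_space = vimage_algebra (Pow verts) (\<lambda>T. \<lambda>v\<in>verts. v \<in> T)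
     (Pi\<^sub>M verts (\<lambda>_. count_space (UNIV :: bool set)))"

definition random_tree_with_law :: "'w measure \<Rightarrow> ('w \<Rightarrow> vertex set) \<Rightarrow> vertex set measure \<Rightarrow> bool" where
  "random_tree_with_law \<Omega> T \<mu> \<longleftrightarrow> T \<in> measurable \<Omega> tree_space \<and> distr \<Omega> tree_space T = \<mu>"

definition uniform_tree :: "nat \<Rightarrow> vertex set measure" where
  "uniform_tree k = distr (uniform_count_measure (ordered_trees_of_size k)) tree_space (\<lambda>T. T)"

text \<open>The library's \<^term>\<open>geometric_pmf q\<close> has mass \<open>(1 - q)\<^sup>k q\<close> at \<open>k\<close>, so its parameter here
  is \<open>1 - p\<close>; see \<open>pmf_offspring\<close> below.\<close>

definition offspring :: "real \<Rightarrow> enat pmf" where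
  "offspring p = (if p = 1 then return_pmf \<infinity> else map_pmf enat (geometric_pmf (1 - p)))"

fun gw_level :: "(vertex \<Rightarrow> enat) \<Rightarrow> nat \<Rightarrow> vertex set" where
  "gw_level X 0 = {[]}"
| "gw_level X (Suc n) = (\<Union>v\<in>gw_level X n. {v @ [i] | i. 1 \<le> i \<and> enat i \<le> X v})"

definition gw_tree :: "(vertex \<Rightarrow> enat) \<Rightarrow> vertex set" where
  "gw_tree X = (\<Union>n. gw_level X n)"

definition gw_law :: "real \<Rightarrow> vertex set measure" where
  "gw_law p = distr (Pi\<^sub>M verts (\<lambda>_. measure_pmf (offspring p))) tree_space gw_tree"

definition increasing_coupling :: "'w measure \<Rightarrow> (nat \<Rightarrow> 'w \<Rightarrow> vertex set) \<Rightarrow> bool" where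
  "increasing_coupling \<Omega> T \<longleftrightarrow> prob_space \<Omega> \<and>
     (\<forall>k\<ge>1. random_tree_with_law \<Omega> (T k) (uniform_tree k)) \<and>
     \<P>(\<omega> in \<Omega>. \<forall>k\<ge>1. T k \<omega> \<subseteq> T (Suc k) \<omega>) = 1"

text \<open>An increasing coupling exists by a theorem of Luczak and Winkler, and the law of the union
  is the same for all of them, so the choice made by \<open>SOME\<close> is immaterial. Restricting to
  probability spaces over sequences of vertex sets loses no generality: any coupling can be
  replaced by its joint law.\<close>

definition infinite_tree_half :: "vertex set measure" where
  "infinite_tree_half = (SOME \<mu>. \<exists>(\<Omega> :: (nat \<Rightarrow> vertex set) measure) T.
     increasing_coupling \<Omega> T \<and> \<mu> = distr \<Omega> tree_space (\<lambda>\<omega>. \<Union>k\<in>{1..}. T k \<omega>))"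

text \<open>For \<open>p > 1/2\<close> this is the law of the Galton--Watson tree conditioned on being infinite.\<close>

definition infinite_tree :: "real \<Rightarrow> vertex set measure" where
  "infinite_tree p = (if p = 1/2 then infinite_tree_half
     else uniform_measure (gw_law p) {T \<in> space tree_space. infinite T})"

text \<open>The following facts confirm that the laws above are well defined.\<close>

lemma pmf_offspring:
  assumes "0 < p" "p < 1"
  shows "pmf (offspring p) (enat k) = p ^ k * (1 - p)"
proof -
  have "pmf (map_pmf enat (geometric_pmf (1 - p))) (enat k) = pmf (geometric_pmf (1 - p)) k"
    by (rule pmf_map_inj') (simp add: inj_def)
  then show ?thesis using assms by (simp add: offspring_def)
qed

lemma space_tree_space [simp]: "space tree_space = Pow verts"
  by (simp add: tree_space_def)

lemma measurable_tree_spaceI: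
  assumes "\<And>x. x \<in> space M \<Longrightarrow> f x \<subseteq> verts"
    and "\<And>v. v \<in> verts \<Longrightarrow> Measurable.pred M (\<lambda>x. v \<in> f x)"
  shows "f \<in> measurable M tree_space"
  unfolding tree_space_def
  by (rule measurable_vimage_algebra2) (use assms in \<open>auto intro!: measurable_restrict\<close>)

lemma pred_mem_tree_space:
  assumes "v \<in> verts"
  shows "Measurable.pred tree_space (\<lambda>T. v \<in> T)"
proof -
  have "(\<lambda>T. \<lambda>v\<in>verts. v \<in> T) \<in> measurable tree_space (Pi\<^sub>M verts (\<lambda>_. count_space UNIV))"
    unfolding tree_space_def by (rule measurable_vimage_algebra1) (auto simp: space_PiM)
  from measurable_compose[OF this measurable_component_singleton[OF assms]]
  show ?thesis using assms by simp
qed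

lemma countable_verts: "countable verts"
  by (rule countable_subset[OF subset_UNIV]) simp

lemma infinite_trees_measurable:
  "{T \<in> space tree_space. infinite T} \<in> sets tree_space"
proof -
  have eq: "{T \<in> space tree_space. infinite T} = space tree_space -
     (\<Union>F\<in>{F. F \<subseteq> verts \<and> finite F}. {T \<in> space tree_space. \<forall>v\<in>verts. v \<in> T \<longleftrightarrow> v \<in> F})"
    by auto (metis subset_antisym subset_eq)
  have "{T \<in> space tree_space. \<forall>v\<in>verts. v \<in> T \<longleftrightarrow> v \<in> F} \<in> sets tree_space" for F
  proof -
    have "Measurable.pred tree_space (\<lambda>T. v \<in> verts \<longrightarrow> (v \<in> T \<longleftrightarrow> v \<in> F))" for v
    proof (cases "v \<in> verts")
      case True
      from pred_mem_tree_space[OF this] show ?thesis by (intro pred_intros_logic) auto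
    qed simp
    then have "Measurable.pred tree_space (\<lambda>T. \<forall>v. v \<in> verts \<longrightarrow> (v \<in> T \<longleftrightarrow> v \<in> F))"
      by (rule pred_intros_countable)
    then show ?thesis by (simp add: pred_def Ball_def)
  qed
  moreover have "countable {F. F \<subseteq> verts \<and> finite F}"
    using countable_Collect_finite_subset[OF countable_verts] by (simp add: conj_commute)
  ultimately show ?thesis unfolding eq by (intro sets.Diff sets.top sets.countable_UN') auto
qed

lemma mem_gw_level_iff:
  "v \<in> gw_level X n \<longleftrightarrow> length v = n \<and> (\<forall>i<n. 1 \<le> v ! i \<and> enat (v ! i) \<le> X (take i v))"
proof (induction n arbitrary: v)
  case (Suc n)
  show ?case
  proof (cases v rule: rev_cases)
    case (snoc w a)
    then show ?thesis using Suc.IH[of w] by (auto simp: nth_append less_Suc_eq)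
  qed auto
qed simp

lemma mem_gw_tree_iff:
  "v \<in> gw_tree X \<longleftrightarrow> v \<in> verts \<and> (\<forall>i<length v. enat (v ! i) \<le> X (take i v))"
  by (auto simp: gw_tree_def mem_gw_level_iff verts_def all_set_conv_all_nth)

lemma take_in_verts: "v \<in> verts \<Longrightarrow> take i v \<in> verts"
  by (auto simp: verts_def dest: in_set_takeD)

lemma gw_tree_measurable:
  "gw_tree \<in> measurable (Pi\<^sub>M verts (\<lambda>_. measure_pmf (offspring p))) tree_space"
proof (rule measurable_tree_spaceI)
  fix v assume v: "v \<in> verts"
  have "Measurable.pred (Pi\<^sub>M verts (\<lambda>_. measure_pmf (offspring p))) (\<lambda>X. enat (v ! i) \<le> X (take i v))"
    for i
    by (rule measurable_compose[OF measurable_component_singleton[OF take_in_verts[OF v]]]) simp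
  then show "Measurable.pred (Pi\<^sub>M verts (\<lambda>_. measure_pmf (offspring p))) (\<lambda>X. v \<in> gw_tree X)"
    unfolding mem_gw_tree_iff using v by (intro pred_intros_logic pred_intros_countable) auto
qed (auto simp: mem_gw_tree_iff)

lemma ordered_tree_parent:
  assumes "T \<in> ordered_trees" "v \<in> T" "v \<noteq> []"
  shows "butlast v \<in> T"
proof -
  have "(v, []) \<in> (parent_edges T \<union> (parent_edges T)\<inverse>)\<^sup>*"
    using assms by (auto simp: ordered_trees_def is_tree_def)
  then have "take (length v) [] = v \<or> butlast v \<in> T"
  proof induction
    case (step y z)
    have "take (length v) z = v \<or> butlast v \<in> T" if y: "take (length v) y = v"
    proof -
      consider "z = butlast y" "z \<in> T" "y \<noteq> []" | "y = butlast z" "z \<noteq> []"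
        using step.hyps by (auto simp: parent_edges_def)
      then show ?thesis
      proof cases
        case 1
        show ?thesis
        proof (cases "length y = length v")
          case True
          with y 1 show ?thesis by simp
        next
          case False
          moreover have "length v \<le> length y" using y by (metis length_take min.cobounded1 min_def)
          ultimately have "length v \<le> length y - 1" by simp
          then show ?thesis using y 1 by (simp add: butlast_conv_take min_def)
        qed
      next
        case 2
        have "length v \<le> length y" using y by (metis length_take min.cobounded1 min_def)
        then show ?thesis using y 2 by (simp add: butlast_conv_take min_def split: if_splits)
      qed
    qed
    with step.IH show ?case by blast
  qed simp
  with \<open>v \<noteq> []\<close> show ?thesis by simp
qed

lemma ordered_tree_take:
  assumes "T \<in> ordered_trees" "v \<in> T"
  shows "take i v \<in> T"
  using assms(2)
proof (induction v rule: rev_induct)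
  case (snoc a v)
  then show ?case
    using ordered_tree_parent[OF assms(1), of "v @ [a]"] by (cases "i \<le> length v") auto
qed simp

lemma ordered_tree_sibling:
  assumes "T \<in> ordered_trees" "v @ [a + d] \<in> T" "1 \<le> a"
  shows "v @ [a] \<in> T"
  using assms(2)
proof (induction d)
  case (Suc d)
  have "2 \<le> last (v @ [a + Suc d])" using assms(3) by simp
  with assms(1) Suc.prems have "butlast (v @ [a + Suc d]) @ [last (v @ [a + Suc d]) - 1] \<in> T"
    unfolding ordered_trees_def by blast
  then show ?case using Suc.IH by simp
qed simp

lemma finite_ordered_trees_of_size: "finite (ordered_trees_of_size k)"
proof (rule finite_subset)
  let ?L = "{v. set v \<subseteq> {..k} \<and> length v \<le> k}"
  show "finite (Pow ?L)" using finite_lists_length_le[of "{..k}" k] by simp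
  show "ordered_trees_of_size k \<subseteq> Pow ?L"
  proof (intro subsetI PowI)
    fix T v assume T: "T \<in> ordered_trees_of_size k" and v: "v \<in> T"
    then have F: "T \<in> ordered_trees" and fin: "finite T" and card: "card T = k"
      by (auto simp: ordered_trees_of_size_def)
    have "inj_on (\<lambda>i. take i v) {..<length v}"
      by (rule inj_onI) (metis length_take lessThan_iff min.strict_order_iff min.commute)
    then have "length v = card ((\<lambda>i. take i v) ` {..<length v})" by (simp add: card_image)
    also have "\<dots> \<le> k" unfolding card[symmetric]
      by (rule card_mono[OF fin]) (use ordered_tree_take[OF F v] in auto)
    finally have len: "length v \<le> k" .
    have "x \<le> k" if "x \<in> set v" for x
    proof -
      from that obtain i where i: "i < length v" "v ! i = x" by (auto simp: in_set_conv_nth)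
      have "take i v @ [x] \<in> T"
        using ordered_tree_take[OF F v, of "Suc i"] i by (simp add: take_Suc_conv_app_nth)
      then have sub: "(\<lambda>a. take i v @ [a]) ` {1..x} \<subseteq> T"
        using ordered_tree_sibling[OF F, of "take i v" _ "x - _"]
        by (auto) (metis le_add_diff_inverse ordered_tree_sibling[OF F] One_nat_def)
      have "x = card ((\<lambda>a. take i v @ [a]) ` {1..x})" by (subst card_image) (auto simp: inj_on_def)
      also have "\<dots> \<le> k" unfolding card[symmetric] by (rule card_mono[OF fin sub])
      finally show ?thesis .
    qed
    with len show "v \<in> ?L" by auto
  qed
qed

lemma ordered_trees_of_size_nonempty:
  assumes "1 \<le> k"
  shows "ordered_trees_of_size k \<noteq> {}"
proof -
  define T where "T = insert [] ((\<lambda>i. [i]) ` {1..<k})"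
  have root: "(u, []) \<in> (parent_edges T \<union> (parent_edges T)\<inverse>)\<^sup>*"
       "([], u) \<in> (parent_edges T \<union> (parent_edges T)\<inverse>)\<^sup>*" if "u \<in> T" for u
  proof -
    have "u = [] \<or> (u, []) \<in> parent_edges T" using that by (auto simp: T_def parent_edges_def)
    then show "(u, []) \<in> (parent_edges T \<union> (parent_edges T)\<inverse>)\<^sup>*"
       "([], u) \<in> (parent_edges T \<union> (parent_edges T)\<inverse>)\<^sup>*" by auto
  qed
  have "is_tree T" unfolding is_tree_def
  proof (intro conjI ballI)
    show "T \<subseteq> verts" by (auto simp: T_def verts_def)
    show "(u, v) \<in> (parent_edges T \<union> (parent_edges T)\<inverse>)\<^sup>*" if "u \<in> T" "v \<in> T" for u v
      using root(1)[OF that(1)] root(2)[OF that(2)] by (rule rtrancl_trans)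
  qed
  moreover have "card T = k"
  proof -
    have "card T = Suc (card ((\<lambda>i. [i]) ` {1..<k}))"
      unfolding T_def by (rule card_insert_disjoint) auto
    also have "\<dots> = Suc (k - 1)" by (subst card_image) (auto simp: inj_on_def)
    finally show ?thesis using assms by simp
  qed
  moreover have "[] \<in> T" "finite T" by (simp_all add: T_def)
  moreover have "\<forall>v\<in>T. v \<noteq> [] \<and> last v \<ge> 2 \<longrightarrow> butlast v @ [last v - 1] \<in> T"
    by (auto simp: T_def image_iff)
  ultimately have "T \<in> ordered_trees_of_size k"
    by (simp add: ordered_trees_of_size_def ordered_trees_def)
  then show ?thesis by blast
qed

lemma uniform_tree_measurable:
  "(\<lambda>T. T) \<in> measurable (uniform_count_measure (ordered_trees_of_size k)) tree_space"
  by (rule measurable_tree_spaceI)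
     (auto simp: uniform_count_measure_def pred_def point_measure_def
        ordered_trees_of_size_def ordered_trees_def is_tree_def)

end

theory Submission
  imports Defs
begin

text \<open>
  Coding the first child of a vertex as its left child and its next sibling as its right child turns
  an ordered tree with \<open>n + 1\<close> vertices into a binary tree with \<open>n\<close> nodes. Inclusion of vertex sets
  becomes inclusion of binary trees, and the geometric Galton--Watson tree becomes the open cluster
  of site percolation with parameter \<open>p\<close> on the infinite binary tree. In all the laws involved, a
  tree of total size \<open>N\<close> (a natural number or \<open>\<infinity>\<close>) is generated recursively: the sizes \<open>(L, R)\<close> of
  the two subtrees of the top node have a law \<open>W N\<close>, and given these sizes the subtrees are independent trees
  of sizes \<open>L\<close> and \<open>R\<close> of the same kind. For finite \<open>N\<close> this is the uniform tree, with weights given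
  by Catalan numbers; for \<open>N = \<infinity>\<close> it is the percolation cluster conditioned to be infinite.

  A coupling of trees of sizes \<open>m \<le> N\<close> with inclusion therefore follows by induction on the height
  (\<open>tree_pmf_mono\<close>) once the size pairs under \<open>W m\<close> and \<open>W N\<close> can be coupled so that both components
  increase (\<open>size_split_mono\<close>). That is a statement about distributions on the integers:

  \<^item> From \<open>n\<close> to \<open>n + 1\<close> one of the two subtrees has to gain one node. Such a coupling exists as soon
    as the distribution functions of the left sizes interlace, which is the log-convexity of the
    Catalan numbers (\<open>catalan_split_step\<close>). This is the theorem of Luczak and Winkler.

  \<^item> From \<open>n\<close> to \<open>\<infinity>\<close> at least one target size is infinite. Targets \<open>(i, \<infinity>)\<close> and \<open>(\<infinity>, n - i)\<close> with
    small finite entry are matched exactly with the source \<open>(i, n - i)\<close>, and any other target has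
    both entries above \<open>n\<close> and accepts every source. The matching is possible because \<open>4 ^ n\<close>
    divided by the \<open>n\<close>-th Catalan number is, up to a shift of the index by one, superadditive
    (\<open>inverse_catalan_superadditive\<close>, \<open>size_split_infinity_dominates\<close>).

  At \<open>p = 1/2\<close> the infinite tree is the union of an increasing coupling of the uniform trees, so each
  of them lies inside it; what has to be shown is that an increasing coupling exists, and it is
  assembled from the one-step couplings as a Markov chain (\<open>rel_pmf_chain\<close>). For \<open>p > 1/2\<close> the
  event that the uniform tree of size \<open>n + 1\<close> lies in the infinite tree depends only on the part of
  the infinite tree of binary height at most \<open>n\<close>. The law of this part is identified
  (\<open>gw_trunc_infinite\<close>), and a coupling with it extends to the whole infinite tree by sampling the
  uniform tree from its conditional law given that part (\<open>rel_pmf_extend_space\<close>).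
\<close>

section \<open>Catalan numbers\<close>

text \<open>Real-valued and given by the ratio of consecutive terms, because the proofs compare such ratios;
  that these are the Catalan numbers of the convolution recurrence is \<open>catalan_convolution\<close>.\<close>

fun catalan :: "nat \<Rightarrow> real" where
  "catalan 0 = 1"
| "catalan (Suc n) = (4 * real n + 2) / (real n + 2) * catalan n"

lemma catalan_pos [simp]: "0 < catalan n"
  by (induction n) auto

lemma catalan_nonneg [simp]: "0 \<le> catalan n"
  using catalan_pos[of n] by linarith

lemma catalan_nonzero [simp]: "catalan n \<noteq> 0"
  using catalan_pos[of n] by linarith

lemma catalan_Suc_mult: "(real n + 2) * catalan (Suc n) = (4 * real n + 2) * catalan n"
  by (simp add: field_simps)

text \<open>Write \<open>S n\<close> for the convolution. By the symmetry \<open>i \<mapsto> n - i\<close>, weighting its terms by \<open>i + 1\<close> multiplies it by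
  \<open>(n + 2) / 2\<close>. Evaluating the same weighted sum with the ratio recurrence expresses \<open>S (n + 1)\<close>
  through \<open>S n\<close>, and the two sequences then satisfy the same recurrence.\<close>

lemma catalan_convolution: "(\<Sum>i\<le>n. catalan i * catalan (n - i)) = catalan (Suc n)"
proof (induction n)
  case 0
  show ?case by simp
next
  case (Suc n)
  define S where "S m = (\<Sum>i\<le>m. catalan i * catalan (m - i))" for m
  have moment: "2 * (\<Sum>i\<le>m. (real i + 1) * (catalan i * catalan (m - i))) = (real m + 2) * S m" for m
  proof -
    have "(\<Sum>i\<le>m. (real i + 1) * (catalan i * catalan (m - i)))
        = (\<Sum>i\<le>m. (real (m - i) + 1) * (catalan i * catalan (m - i)))"
      by (rule sum.reindex_bij_witness[of _ "\<lambda>i. m - i" "\<lambda>i. m - i"]) auto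
    then have "2 * (\<Sum>i\<le>m. (real i + 1) * (catalan i * catalan (m - i)))
        = (\<Sum>i\<le>m. (real i + 1) * (catalan i * catalan (m - i)) + (real (m - i) + 1) * (catalan i * catalan (m - i)))"
      by (simp add: sum.distrib)
    also have "\<dots> = (\<Sum>i\<le>m. (real m + 2) * (catalan i * catalan (m - i)))"
      by (intro sum.cong refl) (auto simp: of_nat_diff algebra_simps)
    finally show ?thesis by (simp add: S_def sum_distrib_left)
  qed
  define X where "X = (\<Sum>i\<le>Suc n. (real i + 1) * (catalan i * catalan (Suc n - i)))"
  have X: "2 * X = (real (Suc n) + 2) * S (Suc n)" unfolding X_def by (rule moment)
  have "X = catalan (Suc n) + (\<Sum>i\<le>n. (real i + 2) * catalan (Suc i) * catalan (n - i))"
    unfolding X_def by (subst sum.atMost_Suc_shift) (simp add: algebra_simps del: catalan.simps(2))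
  also have "(\<Sum>i\<le>n. (real i + 2) * catalan (Suc i) * catalan (n - i))
      = (\<Sum>i\<le>n. 4 * ((real i + 1) * (catalan i * catalan (n - i))) - 2 * (catalan i * catalan (n - i)))"
    unfolding catalan_Suc_mult by (intro sum.cong refl) (simp add: algebra_simps del: catalan.simps(2))
  also have "\<dots> = 2 * ((real n + 2) * S n) - 2 * S n"
    unfolding sum_subtractf sum_distrib_left[symmetric] using moment[of n] by (simp add: S_def)
  finally have "(real n + 3) * S (Suc n) = 2 * (catalan (Suc n) + (2 * real n + 2) * S n)"
    using X by (simp add: algebra_simps del: catalan.simps(2))
  also have "\<dots> = (real n + 3) * catalan (Suc (Suc n))"
    using Suc catalan_Suc_mult[of "Suc n"] by (simp add: S_def algebra_simps del: catalan.simps(2))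
  finally have "S (Suc n) = catalan (Suc (Suc n))"
    by (simp del: catalan.simps(2))
  then show ?case by (simp only: S_def)
qed

text \<open>The ratios \<open>(4 n + 2) / (n + 2) = 4 - 6 / (n + 2)\<close> increase.\<close>

lemma catalan_log_convex:
  assumes "m \<le> n"
  shows "catalan (Suc m) * catalan n \<le> catalan m * catalan (Suc n)"
proof -
  have "(4 * real m + 2) / (real m + 2) \<le> (4 * real n + 2) / (real n + 2)"
    using assms by (simp add: field_simps)
  then have "(4 * real m + 2) / (real m + 2) * (catalan m * catalan n)
      \<le> (4 * real n + 2) / (real n + 2) * (catalan m * catalan n)"
    by (intro mult_right_mono) auto
  then show ?thesis by (simp add: mult_ac)
qed

text \<open>The sequence \<open>e n = 4 ^ n / catalan n\<close> is convex, so \<open>e (i + j) - e j \<ge> e i - e 0 = e i - 1\<close>, and the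
  next increment, being at least the first one, which is 3, makes up for the missing 1.\<close>

lemma inverse_catalan_superadditive:
  "4 ^ i / catalan i + 4 ^ j / catalan j \<le> 4 ^ Suc (i + j) / catalan (Suc (i + j))"
proof -
  define e where "e n = 4 ^ n / catalan n" for n
  have e_Suc: "e (Suc n) = e n * ((2 * real n + 4) / (2 * real n + 1))" for n
  proof -
    have "4 / ((4 * real n + 2) / (real n + 2)) = (2 * real n + 4) / (2 * real n + 1)"
      by (simp add: divide_simps) (simp add: algebra_simps)
    moreover have "e (Suc n) = e n * (4 / ((4 * real n + 2) / (real n + 2)))"
      by (simp add: e_def) (simp add: algebra_simps)
    ultimately show ?thesis by simp
  qed
  have e_pos: "0 < e n" for n by (simp add: e_def)
  define d where "d n = e (Suc n) - e n" for n
  have d_eq: "d n = 3 * (e n / (2 * real n + 1))" for n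
    by (simp add: d_def e_Suc field_simps)
  have "d n \<le> d (Suc n)" for n
  proof -
    have "d (Suc n) = d n * ((2 * real n + 4) / (2 * real n + 3))" by (simp add: d_eq e_Suc mult.assoc add.commute)
    moreover have "0 \<le> d n" using e_pos[of n] by (simp add: d_eq)
    ultimately show ?thesis by (simp add: pos_le_divide_eq mult_left_mono)
  qed
  then have d_mono: "d m \<le> d n" if "m \<le> n" for m n
    using that by (rule lift_Suc_mono_le)
  have d0: "d 0 = 3" by (simp add: d_eq e_def)
  have "e (i + j) - e j \<ge> e i - e 0"
  proof (induction i)
    case (Suc i)
    then show ?case using d_mono[of i "i + j"] by (simp add: d_def)
  qed simp
  moreover have "d (i + j) \<ge> 3" using d_mono[of 0 "i + j"] d0 by simp
  ultimately have "e i + e j \<le> e (Suc (i + j))" by (simp add: d_def e_def)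
  then show ?thesis by (simp add: e_def)
qed

text \<open>With \<open>x = p (1 - p)\<close> the sum \<open>c\<close> solves \<open>c = 1 + x c\<^sup>2\<close>, whose roots are \<open>1 / p\<close> and, for \<open>p < 1\<close>,
  \<open>1 / (1 - p)\<close>.
  The partial sums stay below \<open>1 / p\<close>, by the same recurrence, and this selects the root.\<close>

lemma catalan_gf_sums:
  fixes p :: real
  assumes "1/2 < p" "p \<le> 1"
  shows "(\<lambda>n. catalan n * (p * (1 - p)) ^ n) sums (1 / p)"
proof -
  define x where "x = p * (1 - p)"
  have x0: "0 \<le> x" using assms by (simp add: x_def)
  define a where "a n = catalan n * x ^ n" for n
  have a0: "0 \<le> a n" for n using x0 by (simp add: a_def)
  have conv: "a (Suc n) = x * (\<Sum>i\<le>n. a i * a (n - i))" for n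
  proof -
    have "(\<Sum>i\<le>n. a i * a (n - i)) = (\<Sum>i\<le>n. catalan i * catalan (n - i) * x ^ n)"
      by (intro sum.cong refl) (simp add: a_def flip: power_add)
    also have "\<dots> = catalan (Suc n) * x ^ n" by (simp only: catalan_convolution flip: sum_distrib_right)
    finally show ?thesis by (simp add: a_def del: catalan.simps(2))
  qed
  have bound: "(\<Sum>i<n. a i) \<le> 1 / p" for n
  proof (induction n)
    case (Suc n)
    have "(\<Sum>m<n. \<Sum>i\<le>m. a i * a (m - i)) = (\<Sum>(i,j)\<in>{(i,j). i + j < n}. a i * a j)"
      by (rule sum.triangle_reindex[symmetric])
    also have "\<dots> \<le> (\<Sum>(i,j)\<in>{..<n} \<times> {..<n}. a i * a j)"
      by (rule sum_mono2) (auto simp: a0)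
    also have "\<dots> = (\<Sum>i<n. a i) * (\<Sum>i<n. a i)" by (simp add: sum_product sum.cartesian_product)
    also have "\<dots> \<le> (1 / p) * (1 / p)" using Suc assms by (intro mult_mono sum_nonneg) (auto simp: a0)
    finally have "x * (\<Sum>m<n. \<Sum>i\<le>m. a i * a (m - i)) \<le> x * ((1 / p) * (1 / p))"
      using x0 by (rule mult_left_mono)
    then have "(\<Sum>i<Suc n. a i) \<le> 1 + x * ((1 / p) * (1 / p))"
      by (simp add: sum.lessThan_Suc_shift conv sum_distrib_left a_def[of 0] del: sum.lessThan_Suc)
    also have "\<dots> = 1 / p" using assms by (simp add: x_def field_simps)
    finally show ?case .
  qed (use assms in simp)
  have summ: "summable a" by (rule summableI_nonneg_bounded[OF a0 bound])
  define c where "c = suminf a"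
  have cp: "c \<le> 1 / p" unfolding c_def by (rule suminf_le_const[OF summ bound])
  have "(\<lambda>n. \<Sum>i\<le>n. a i * a (n - i)) sums (c * c)"
    unfolding c_def by (rule Cauchy_product_sums) (use summ a0 in simp_all)
  then have "(\<lambda>n. a (Suc n)) sums (x * (c * c))" unfolding conv by (rule sums_mult)
  then have "a sums (x * (c * c) + 1)" by (simp add: sums_Suc_iff a_def[of 0])
  then have eq: "c = x * (c * c) + 1" unfolding c_def using sums_unique by metis
  \<comment> \<open>The factor \<open>(1 - p) c - 1\<close> is negative because of \<open>c \<le> 1 / p\<close> and \<open>1 - p < p\<close>.\<close>
  have "(p * c - 1) * ((1 - p) * c - 1) = 0" using eq by (simp add: x_def algebra_simps)
  moreover have "(1 - p) * c < 1"
  proof -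
    have "(1 - p) * c \<le> (1 - p) * (1 / p)" using cp assms by (intro mult_left_mono) auto
    also have "\<dots> < 1" using assms by (simp add: field_simps)
    finally show ?thesis .
  qed
  ultimately have "p * c = 1" by simp
  then have "c = 1 / p" using assms by (simp add: field_simps)
  moreover have "a sums c" unfolding c_def by (rule summable_sums[OF summ])
  ultimately show ?thesis by (simp add: a_def[abs_def] x_def)
qed

section \<open>Couplings of discrete distributions\<close>

text \<open>The measure of \<open>A\<close> is the point mass at \<open>True\<close> of the image under membership in \<open>A\<close>, which
  reduces the claim to \<open>pmf_bind\<close>.\<close>

lemma measure_bind_pmf: "measure (bind_pmf M f) A = (\<integral>x. measure (f x) A \<partial>measure_pmf M)"
proof -
  have *: "measure (measure_pmf q) A = pmf (map_pmf (\<lambda>x. x \<in> A) q) True" for q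
    by (simp add: pmf_map vimage_def)
  show ?thesis unfolding * map_bind_pmf by (rule pmf_bind)
qed

lemma pair_bind_pmf:
  "pair_pmf (bind_pmf A f) (bind_pmf B g) = bind_pmf (pair_pmf A B) (\<lambda>(a, b). pair_pmf (f a) (g b))"
  unfolding pair_pmf_def bind_assoc_pmf bind_return_pmf prod.case
  by (intro bind_pmf_cong refl bind_commute_pmf)

lemma rel_pmf_trans:
  assumes "rel_pmf R \<mu> \<nu>" "rel_pmf R \<nu> \<rho>" "transp R"
  shows "rel_pmf R \<mu> \<rho>"
proof -
  have "rel_pmf (R OO R) \<mu> \<rho>" unfolding pmf.rel_compp using assms(1,2) by blast
  then show ?thesis by (rule pmf.rel_mono_strong) (use \<open>transp R\<close> in \<open>auto dest: transpD\<close>)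
qed

text \<open>Disintegration of a coupling: given the first coordinate, draw the second one from its
  conditional law.\<close>

lemma rel_pmf_kernel:
  assumes "rel_pmf R \<mu> \<nu>"
  obtains K where "bind_pmf \<mu> K = \<nu>" "\<And>x y. x \<in> set_pmf \<mu> \<Longrightarrow> y \<in> set_pmf (K x) \<Longrightarrow> R x y"
proof -
  from assms obtain pq where pq: "\<And>x y. (x, y) \<in> set_pmf pq \<Longrightarrow> R x y"
    "map_pmf fst pq = \<mu>" "map_pmf snd pq = \<nu>"
    by cases blast
  define C where "C x = cond_pmf pq {z. x = fst z}" for x
  have ne: "set_pmf pq \<inter> {z. x = fst z} \<noteq> {}" if "x \<in> set_pmf \<mu>" for x
    using that by (auto simp flip: pq(2))
  have "bind_pmf \<mu> C = pq"
    unfolding C_def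
  proof (rule bind_cond_pmf_cancel)
    show "measure (measure_pmf pq) {y. x = fst y} = measure (measure_pmf \<mu>) {x. x = fst y}"
      if "x = fst y" for x y using that by (simp flip: pq(2)) (simp add: vimage_def eq_commute)
  qed (use ne in \<open>auto simp flip: pq(2)\<close>)
  then have "bind_pmf \<mu> (\<lambda>x. map_pmf snd (C x)) = \<nu>"
    by (simp add: pq(3) flip: map_bind_pmf)
  moreover have "R x y" if "x \<in> set_pmf \<mu>" "y \<in> set_pmf (map_pmf snd (C x))" for x y
    using that ne[of x] pq(1) by (auto simp: C_def set_cond_pmf)
  ultimately show ?thesis by (rule that)
qed

text \<open>A partial matching \<open>g\<close> that does not overload any source extends to a coupling if the unmatched
  targets accept every source: draw \<open>y\<close> from \<open>\<nu>\<close>, take \<open>g y\<close> if \<open>y\<close> is matched, and otherwise draw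
  from the mass of \<open>\<mu>\<close> left over by the matching, rescaled to a probability distribution.\<close>

lemma rel_pmf_overlap:
  fixes \<mu> :: "'a pmf" and \<nu> :: "'b pmf"
  assumes dom: "\<And>x. measure \<nu> {y \<in> G. g y = x} \<le> pmf \<mu> x"
    and free: "\<not> set_pmf \<nu> \<subseteq> G"
    and matched: "\<And>y. y \<in> set_pmf \<nu> \<Longrightarrow> y \<in> G \<Longrightarrow> R (g y) y"
    and unmatched: "\<And>x y. x \<in> set_pmf \<mu> \<Longrightarrow> y \<in> set_pmf \<nu> \<Longrightarrow> y \<notin> G \<Longrightarrow> R x y"
  shows "rel_pmf R \<mu> \<nu>"
proof -
  define m where "m = measure \<nu> (- G)"
  have m: "0 < m"
  proof -
    from free obtain y where "y \<in> set_pmf \<nu>" "y \<in> - G" by auto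
    then show ?thesis unfolding m_def by (rule measure_pmf_posI)
  qed
  define \<sigma> where "\<sigma> x = measure \<nu> {y \<in> G. g y = x}" for x
  have \<sigma>_le: "\<sigma> x \<le> pmf \<mu> x" and \<sigma>_nonneg: "0 \<le> \<sigma> x" for x
    using dom[of x] by (simp_all add: \<sigma>_def)
  define \<nu>' where "\<nu>' = map_pmf (\<lambda>y. if y \<in> G then Some (g y) else None) \<nu>"
  have Some: "pmf \<nu>' (Some x) = \<sigma> x" for x
    unfolding \<nu>'_def pmf_map \<sigma>_def by (rule arg_cong[where f = "measure \<nu>"]) (auto split: if_splits)
  have None: "pmf \<nu>' None = m"
    unfolding \<nu>'_def pmf_map m_def by (rule arg_cong[where f = "measure \<nu>"]) (auto split: if_splits)
  have "(\<integral>\<^sup>+ x. pmf \<nu>' (Some x) \<partial>count_space UNIV) = (\<integral>\<^sup>+ x. pmf \<nu>' x \<partial>count_space (range Some))"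
    by (rule nn_integral_bij_count_space) (auto simp: bij_betw_def inj_on_def)
  also have "\<dots> = emeasure \<nu>' (range Some)" by (rule nn_integral_pmf)
  also have "range Some = space \<nu>' - {None}" by (auto simp: notin_range_Some)
  also have "emeasure \<nu>' (space \<nu>' - {None}) = ennreal (1 - m)"
    using m by (subst emeasure_compl)
      (auto simp: emeasure_pmf_single None ennreal_minus measure_pmf.emeasure_space_1[simplified] simp flip: ennreal_1)
  finally have \<sigma>: "(\<integral>\<^sup>+ x. \<sigma> x \<partial>count_space UNIV) = ennreal (1 - m)" by (simp add: Some)
  have "(\<integral>\<^sup>+ x. ennreal (pmf \<mu> x - \<sigma> x) \<partial>count_space UNIV)
      = (\<integral>\<^sup>+ x. ennreal (pmf \<mu> x) - ennreal (\<sigma> x) \<partial>count_space UNIV)"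
    by (intro nn_integral_cong) (simp add: \<sigma>_nonneg ennreal_minus)
  also have "\<dots> = (\<integral>\<^sup>+ x. pmf \<mu> x \<partial>count_space UNIV) - (\<integral>\<^sup>+ x. \<sigma> x \<partial>count_space UNIV)"
    by (rule nn_integral_diff) (use \<sigma>_le in \<open>auto simp: \<sigma>\<close>)
  also have "\<dots> = 1 - ennreal (1 - m)" by (simp add: \<sigma> nn_integral_pmf measure_pmf.emeasure_space_1[simplified])
  also have "\<dots> = ennreal m" using m None pmf_le_1[of \<nu>' None] by (simp add: ennreal_minus flip: ennreal_1)
  finally have excess: "(\<integral>\<^sup>+ x. ennreal (pmf \<mu> x - \<sigma> x) \<partial>count_space UNIV) = ennreal m" .
  define \<rho> where "\<rho> = embed_pmf (\<lambda>x. (pmf \<mu> x - \<sigma> x) / m)"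
  have \<rho>: "pmf \<rho> x = (pmf \<mu> x - \<sigma> x) / m" for x
    unfolding \<rho>_def
  proof (rule pmf_embed_pmf)
    show "0 \<le> (pmf \<mu> x - \<sigma> x) / m" for x using \<sigma>_le[of x] m by simp
    have "(\<integral>\<^sup>+ x. ennreal ((pmf \<mu> x - \<sigma> x) / m) \<partial>count_space UNIV)
      = (\<integral>\<^sup>+ x. ennreal (pmf \<mu> x - \<sigma> x) / ennreal m \<partial>count_space UNIV)"
      using \<sigma>_le m by (intro nn_integral_cong) (simp add: divide_ennreal)
    also have "\<dots> = ennreal m / ennreal m" by (simp add: nn_integral_divide excess)
    also have "\<dots> = 1" using m by simp
    finally show "(\<integral>\<^sup>+ x. ennreal ((pmf \<mu> x - \<sigma> x) / m) \<partial>count_space UNIV) = 1" .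
  qed
  define K where "K y = (if y \<in> G then return_pmf (g y) else \<rho>)" for y
  have integrable_ind: "integrable \<nu> (indicat_real A)" for A
    by (simp add: measure_pmf.emeasure_eq_measure)
  have "bind_pmf \<nu> K = \<mu>"
  proof (rule pmf_eqI)
    fix x
    have "pmf (bind_pmf \<nu> K) x
      = (\<integral>y. indicator {y \<in> G. g y = x} y + pmf \<rho> x * indicator (- G) y \<partial>\<nu>)"
      unfolding pmf_bind by (intro Bochner_Integration.integral_cong refl)
        (auto simp: K_def indicator_def)
    also have "\<dots> = \<sigma> x + pmf \<rho> x * m"
      by (subst Bochner_Integration.integral_add) (simp_all add: integrable_ind \<sigma>_def m_def)
    finally show "pmf (bind_pmf \<nu> K) x = pmf \<mu> x" using m by (simp add: \<rho>)
  qed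
  have "set_pmf \<rho> \<subseteq> set_pmf \<mu>"
  proof
    fix x assume "x \<in> set_pmf \<rho>"
    then have "pmf \<rho> x \<noteq> 0" by (simp add: set_pmf_iff)
    then have "pmf \<mu> x \<noteq> \<sigma> x" by (simp add: \<rho>)
    then show "x \<in> set_pmf \<mu>" using \<sigma>_le[of x] \<sigma>_nonneg[of x] by (auto simp: set_pmf_iff)
  qed
  then have "rel_pmf R (bind_pmf \<nu> K) (bind_pmf \<nu> return_pmf)"
    using matched unmatched by (intro rel_pmf_bindI[of "\<lambda>x y. x = y \<and> x \<in> set_pmf \<nu>"])
      (auto simp: K_def rel_pmf_return_pmf2 intro!: rel_pmf_reflI)
  then show ?thesis by (simp add: \<open>bind_pmf \<nu> K = \<mu>\<close> bind_return_pmf')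
qed

text \<open>The mass that has to move from \<open>i\<close> to \<open>i + 1\<close> is the difference of the two distribution functions at
  \<open>i\<close>. The hypotheses say that it is nonnegative and that no more than the mass at \<open>i\<close> has to move.\<close>

lemma rel_pmf_unit_step:
  fixes \<mu> \<nu> :: "nat pmf"
  assumes lower: "\<And>i. (\<Sum>j\<le>i. pmf \<nu> j) \<le> (\<Sum>j\<le>i. pmf \<mu> j)"
    and upper: "\<And>i. (\<Sum>j\<le>i. pmf \<mu> j) \<le> (\<Sum>j\<le>Suc i. pmf \<nu> j)"
  shows "rel_pmf (\<lambda>i j. j = i \<or> j = Suc i) \<mu> \<nu>"
proof -
  define e where "e i = (\<Sum>j\<le>i. pmf \<mu> j) - (\<Sum>j\<le>i. pmf \<nu> j)" for i
  have e0: "0 \<le> e i" for i using lower[of i] by (simp add: e_def)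
  have e_le: "e i \<le> pmf \<mu> i" for i
    using upper[of "i - 1"] by (cases i) (auto simp: e_def)
  \<comment> \<open>If \<open>\<mu>\<close> has no mass at \<open>i\<close>, then \<open>e i = 0\<close> and the quotient is 0 as well.\<close>
  define \<alpha> where "\<alpha> i = e i / pmf \<mu> i" for i
  have \<alpha>01: "0 \<le> \<alpha> i" "\<alpha> i \<le> 1" for i
    using e0[of i] e_le[of i] by (auto simp: \<alpha>_def divide_le_eq_1)
  have \<alpha>: "\<alpha> i * pmf \<mu> i = e i" for i
    using e0[of i] e_le[of i] by (auto simp: \<alpha>_def)
  define K where "K i = map_pmf (\<lambda>b. if b then Suc i else i) (bernoulli_pmf (\<alpha> i))" for i
  have pmf_K: "pmf (K i) j = \<alpha> i * indicator {Suc i} j + (1 - \<alpha> i) * indicator {i} j" for i j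
    unfolding K_def using \<alpha>01[of i]
    by (subst map_pmf_def) (simp add: pmf_bind indicator_def)
  have "bind_pmf \<mu> K = \<nu>"
  proof (rule pmf_eqI)
    fix j
    show "pmf (bind_pmf \<mu> K) j = pmf \<nu> j"
    proof (cases j)
      case 0
      have "pmf (bind_pmf \<mu> K) j = (\<Sum>i\<in>{0}. pmf (K i) j * pmf \<mu> i)"
        unfolding pmf_bind by (rule integral_measure_pmf_real) (auto simp: 0 pmf_K indicator_def split: if_splits)
      then show ?thesis using \<alpha>[of 0] by (simp add: pmf_K 0 left_diff_distrib) (simp add: e_def)
    next
      case (Suc i)
      have "pmf (bind_pmf \<mu> K) j = (\<Sum>i\<in>{i, Suc i}. pmf (K i) j * pmf \<mu> i)"
        unfolding pmf_bind by (rule integral_measure_pmf_real) (auto simp: Suc pmf_K indicator_def split: if_splits)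
      then show ?thesis using \<alpha>[of i] \<alpha>[of "Suc i"]
        by (simp add: pmf_K Suc left_diff_distrib) (simp add: e_def)
    qed
  qed
  moreover have "rel_pmf (\<lambda>i j. j = i \<or> j = Suc i) (bind_pmf \<mu> return_pmf) (bind_pmf \<mu> K)"
    by (rule rel_pmf_bindI[of "(=)"]) (auto simp: rel_pmf_return_pmf1 K_def intro!: rel_pmf_reflI)
  ultimately show ?thesis by (simp add: bind_return_pmf')
qed

text \<open>A variable \<open>X\<close> with law \<open>\<nu>\<close> and, for each \<open>x\<close>, a variable \<open>Y x\<close> with law \<open>K x\<close> that is independent
  of \<open>X\<close>: evaluating the family \<open>Y\<close> at the random index \<open>X\<close> realises one step of the kernel \<open>K\<close>.\<close>

lemma discrete_kernel_law:
  fixes X :: "'w \<Rightarrow> 's::countable" and Y :: "'s \<Rightarrow> 'w \<Rightarrow> 'a::countable"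
  assumes X [measurable]: "X \<in> measurable M (count_space UNIV)"
    and Y [measurable]: "\<And>x. Y x \<in> measurable M (count_space UNIV)"
    and joint: "\<And>x y. emeasure M {\<omega> \<in> space M. X \<omega> = x \<and> Y x \<omega> = y} = ennreal (pmf \<nu> x * pmf (K x) y)"
  shows "(\<lambda>\<omega>. Y (X \<omega>) \<omega>) \<in> measurable M (count_space UNIV)"
    and "distr M (count_space UNIV) (\<lambda>\<omega>. Y (X \<omega>) \<omega>) = measure_pmf (bind_pmf \<nu> K)"
    and "AE \<omega> in M. X \<omega> \<in> set_pmf \<nu> \<and> Y (X \<omega>) \<omega> \<in> set_pmf (K (X \<omega>))"
proof -
  show meas [measurable]: "(\<lambda>\<omega>. Y (X \<omega>) \<omega>) \<in> measurable M (count_space UNIV)"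
    by (rule measurable_compose_countable'[OF Y X]) auto
  show "distr M (count_space UNIV) (\<lambda>\<omega>. Y (X \<omega>) \<omega>) = measure_pmf (bind_pmf \<nu> K)"
  proof (rule measure_eqI_countable[where A = UNIV])
    fix y
    have "emeasure (distr M (count_space UNIV) (\<lambda>\<omega>. Y (X \<omega>) \<omega>)) {y}
        = emeasure M (\<Union>x. {\<omega> \<in> space M. X \<omega> = x \<and> Y x \<omega> = y})"
      by (subst emeasure_distr) (auto intro!: arg_cong[where f = "emeasure M"])
    also have "\<dots> = (\<integral>\<^sup>+ x. emeasure M {\<omega> \<in> space M. X \<omega> = x \<and> Y x \<omega> = y} \<partial>count_space UNIV)"
      by (rule emeasure_UN_countable) (auto simp: disjoint_family_on_def)
    also have "\<dots> = (\<integral>\<^sup>+ x. ennreal (pmf \<nu> x) * ennreal (pmf (K x) y) \<partial>count_space UNIV)"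
      by (simp add: joint ennreal_mult')
    also have "\<dots> = (\<integral>\<^sup>+ x. emeasure (K x) {y} \<partial>\<nu>)"
      by (simp add: nn_integral_measure_pmf emeasure_pmf_single)
    also have "\<dots> = emeasure (measure_pmf (bind_pmf \<nu> K)) {y}" by (rule emeasure_bind_pmf[symmetric])
    finally show "emeasure (distr M (count_space UNIV) (\<lambda>\<omega>. Y (X \<omega>) \<omega>)) {y}
        = emeasure (measure_pmf (bind_pmf \<nu> K)) {y}" .
  qed auto
  have "AE \<omega> in M. \<forall>x y. pmf \<nu> x * pmf (K x) y = 0 \<longrightarrow> \<not> (X \<omega> = x \<and> Y x \<omega> = y)"
    unfolding AE_all_countable
  proof (intro allI)
    fix x y
    show "AE \<omega> in M. pmf \<nu> x * pmf (K x) y = 0 \<longrightarrow> \<not> (X \<omega> = x \<and> Y x \<omega> = y)"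
    proof (cases "pmf \<nu> x * pmf (K x) y = 0")
      case True
      have "{\<omega> \<in> space M. X \<omega> = x \<and> Y x \<omega> = y} \<in> null_sets M"
        using joint[of x y] True by (intro null_setsI) auto
      from AE_not_in[OF this] show ?thesis by (rule AE_mp) (auto intro!: AE_I2)
    qed simp
  qed
  then show "AE \<omega> in M. X \<omega> \<in> set_pmf \<nu> \<and> Y (X \<omega>) \<omega> \<in> set_pmf (K (X \<omega>))"
    by (rule AE_mp) (auto simp: set_pmf_iff intro!: AE_I2)
qed

text \<open>A coupling with a discrete statistic \<open>f\<close> of a random element extends to a coupling with the element
  itself. The extra randomness is one independent sample from the conditional law for each value of
  \<open>f\<close>, of which the one belonging to the actual value is used.\<close>

lemma rel_pmf_extend_space:
  fixes \<mu> :: "'a::countable pmf" and \<nu> :: "'s::countable pmf"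
  assumes M: "prob_space M" and f [measurable]: "f \<in> measurable M (count_space UNIV)"
    and law: "\<And>s. measure M {x \<in> space M. f x = s} = pmf \<nu> s"
    and rel: "rel_pmf R \<mu> \<nu>"
  obtains N :: "('s \<Rightarrow> 'a) measure" and Z where "prob_space N"
    "Z \<in> measurable (M \<Otimes>\<^sub>M N) (count_space UNIV)"
    "distr (M \<Otimes>\<^sub>M N) (count_space UNIV) Z = measure_pmf \<mu>"
    "AE z in M \<Otimes>\<^sub>M N. R (Z z) (f (fst z))"
proof -
  interpret M: prob_space M by (rule M)
  have "rel_pmf (\<lambda>s t. R t s) \<nu> \<mu>" using rel pmf.rel_flip[of R \<nu> \<mu>] by (simp add: conversep_iff[abs_def])
  then obtain K where K: "bind_pmf \<nu> K = \<mu>" "\<And>s t. s \<in> set_pmf \<nu> \<Longrightarrow> t \<in> set_pmf (K s) \<Longrightarrow> R t s"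
    by (rule rel_pmf_kernel) blast
  define N where "N = Pi\<^sub>M UNIV (\<lambda>s. measure_pmf (K s))"
  interpret N: product_prob_space "\<lambda>s. measure_pmf (K s)" UNIV ..
  interpret NP: prob_space N unfolding N_def by (intro prob_space_PiM prob_space_measure_pmf)
  have comp [measurable]: "(\<lambda>\<phi>. \<phi> s) \<in> measurable N (count_space UNIV)" for s
    unfolding N_def by (rule measurable_compose[OF measurable_component_singleton[of s]]) auto
  have joint: "emeasure (M \<Otimes>\<^sub>M N) {z \<in> space (M \<Otimes>\<^sub>M N). f (fst z) = s \<and> snd z s = t}
      = ennreal (pmf \<nu> s * pmf (K s) t)" for s t
  proof -
    have "{z \<in> space (M \<Otimes>\<^sub>M N). f (fst z) = s \<and> snd z s = t}
        = {x \<in> space M. f x = s} \<times> {\<phi> \<in> space N. \<phi> s = t}"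
      by (auto simp: space_pair_measure)
    moreover have "emeasure N {\<phi> \<in> space N. \<phi> s = t} = ennreal (pmf (K s) t)"
      using N.emeasure_PiM_Collect_single[of s "{t}"] by (simp add: N_def emeasure_pmf_single)
    ultimately show ?thesis
      using law[of s] by (simp add: NP.emeasure_pair_measure_Times M.emeasure_eq_measure ennreal_mult')
  qed
  show ?thesis
  proof (rule that)
    show "prob_space N" by (rule NP.prob_space_axioms)
    note * = discrete_kernel_law[of "\<lambda>z. f (fst z)" "M \<Otimes>\<^sub>M N" "\<lambda>s z. snd z s" \<nu> K, OF _ _ joint]
    show "(\<lambda>z. snd z (f (fst z))) \<in> measurable (M \<Otimes>\<^sub>M N) (count_space UNIV)"
      by (rule *(1)) auto
    show "distr (M \<Otimes>\<^sub>M N) (count_space UNIV) (\<lambda>z. snd z (f (fst z))) = measure_pmf \<mu>"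
      unfolding K(1)[symmetric] by (rule *(2)) auto
    have "AE z in M \<Otimes>\<^sub>M N. f (fst z) \<in> set_pmf \<nu> \<and> snd z (f (fst z)) \<in> set_pmf (K (f (fst z)))"
      by (rule *(3)) auto
    then show "AE z in M \<Otimes>\<^sub>M N. R (snd z (f (fst z))) (f (fst z))"
      by (rule AE_mp) (auto intro!: AE_I2 K(2))
  qed
qed

text \<open>Couplings of consecutive laws can be glued into one random sequence by running the Markov chain with
  the disintegrated couplings as transition kernels.\<close>

lemma rel_pmf_chain:
  fixes \<mu> :: "nat \<Rightarrow> 'a::countable pmf"
  assumes rel: "\<And>n. rel_pmf R (\<mu> n) (\<mu> (Suc n))"
  obtains \<Omega> :: "(nat \<times> 'a \<Rightarrow> 'a) measure" and X where "prob_space \<Omega>"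
    "\<And>n. X n \<in> measurable \<Omega> (count_space UNIV)"
    "\<And>n. distr \<Omega> (count_space UNIV) (X n) = measure_pmf (\<mu> n)"
    "AE \<omega> in \<Omega>. \<forall>n. R (X n \<omega>) (X (Suc n) \<omega>)"
proof -
  have "\<exists>K. bind_pmf (\<mu> n) K = \<mu> (Suc n) \<and> (\<forall>x y. x \<in> set_pmf (\<mu> n) \<longrightarrow> y \<in> set_pmf (K x) \<longrightarrow> R x y)" for n
    by (rule rel_pmf_kernel[OF rel[of n]]) blast
  then obtain K where K: "\<And>n. bind_pmf (\<mu> n) (K n) = \<mu> (Suc n)"
    "\<And>n x y. x \<in> set_pmf (\<mu> n) \<Longrightarrow> y \<in> set_pmf (K n x) \<Longrightarrow> R x y" by metis
  \<comment> \<open>Coordinate \<open>(n + 1, x)\<close> holds the move that the chain makes if it is at \<open>x\<close> at time \<open>n\<close>, and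
    coordinate \<open>(0, undefined)\<close> holds its starting point.\<close>
  define L where "L i = (case i of (0, x) \<Rightarrow> \<mu> 0 | (Suc n, x) \<Rightarrow> K n x)" for i :: "nat \<times> 'a"
  define \<Omega> where "\<Omega> = Pi\<^sub>M UNIV (\<lambda>i. measure_pmf (L i))"
  interpret P: product_prob_space "\<lambda>i. measure_pmf (L i)" UNIV ..
  interpret \<Omega>: prob_space \<Omega> unfolding \<Omega>_def by (intro prob_space_PiM prob_space_measure_pmf)
  define X where "X = rec_nat (\<lambda>\<omega> :: nat \<times> 'a \<Rightarrow> 'a. \<omega> (0, undefined)) (\<lambda>n f \<omega>. \<omega> (Suc n, f \<omega>))"
  have X_simps: "X 0 \<omega> = \<omega> (0, undefined)" "X (Suc n) \<omega> = \<omega> (Suc n, X n \<omega>)" for n \<omega>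
    by (simp_all add: X_def)
  have comp: "(\<lambda>\<omega>. \<omega> i) \<in> measurable (Pi\<^sub>M A (\<lambda>i. measure_pmf (L i))) (count_space UNIV)" if "i \<in> A" for i A
    using that by (intro measurable_compose[OF measurable_component_singleton[of i]]) auto
  have X_meas: "X n \<in> measurable (Pi\<^sub>M A (\<lambda>i. measure_pmf (L i))) (count_space UNIV)"
    if "{..n} \<times> UNIV \<subseteq> A" for n A
    using that
  proof (induction n)
    case 0
    then show ?case unfolding X_simps(1)[abs_def] by (intro comp) auto
  next
    case (Suc n)
    have "{..n} \<times> UNIV \<subseteq> A" using Suc.prems by force
    from Suc.IH[OF this] show ?case unfolding X_simps(2)[abs_def]
      by (rule measurable_compose_countable'[rotated]) (use Suc.prems in \<open>auto intro!: comp\<close>)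
  qed
  have X_restrict: "X n (restrict \<omega> A) = X n \<omega>" if "{..n} \<times> UNIV \<subseteq> A" for n \<omega> A
    using that by (induction n) (auto simp: X_simps subset_iff)
  have indep: "\<Omega>.indep_vars (\<lambda>i. measure_pmf (L i)) (\<lambda>i \<omega>. \<omega> i) UNIV"
  proof (subst \<Omega>.indep_vars_iff_distr_eq_PiM)
    show "distr \<Omega> (Pi\<^sub>M UNIV (\<lambda>i. measure_pmf (L i))) (\<lambda>x. \<lambda>i\<in>UNIV. x i)
      = Pi\<^sub>M UNIV (\<lambda>i. distr \<Omega> (measure_pmf (L i)) (\<lambda>\<omega>. \<omega> i))"
      by (simp add: \<Omega>_def P.PiM_component restrict_UNIV distr_id2)
  qed (auto simp: \<Omega>_def)
  have X_meas_\<Omega>: "X n \<in> measurable \<Omega> (count_space UNIV)" for n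
    unfolding \<Omega>_def by (rule X_meas) simp
  have comp_\<Omega>: "(\<lambda>\<omega>. \<omega> i) \<in> measurable \<Omega> (count_space UNIV)" for i
    unfolding \<Omega>_def by (rule comp) simp
  have single: "measure \<Omega> {\<omega> \<in> space \<Omega>. \<omega> i = y} = pmf (L i) y" for i y
    using P.emeasure_PiM_Collect_single[of i "{y}"]
    by (simp add: \<Omega>_def \<Omega>.emeasure_eq_measure[unfolded \<Omega>_def] emeasure_pmf_single)
  have joint: "emeasure \<Omega> {\<omega> \<in> space \<Omega>. X n \<omega> = x \<and> \<omega> (Suc n, x) = y}
      = ennreal (pmf (\<mu> n) x * pmf (K n x) y)"
    if law: "distr \<Omega> (count_space UNIV) (X n) = measure_pmf (\<mu> n)" for n x y
  proof -
    \<comment> \<open>The state at time \<open>n\<close> depends on the coordinates in \<open>A\<close>, the next move out of \<open>x\<close> on the one in \<open>B\<close>.\<close>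
    define A where "A = {..n} \<times> (UNIV :: 'a set)"
    define B where "B = {(Suc n, x)}"
    have "\<Omega>.indep_var (Pi\<^sub>M A (\<lambda>i. measure_pmf (L i))) (\<lambda>\<omega>. restrict \<omega> A)
        (Pi\<^sub>M B (\<lambda>i. measure_pmf (L i))) (\<lambda>\<omega>. restrict \<omega> B)"
      by (rule \<Omega>.indep_var_restrict[OF indep]) (auto simp: A_def B_def)
    then have "\<Omega>.indep_var (count_space UNIV) (X n \<circ> (\<lambda>\<omega>. restrict \<omega> A))
        (count_space UNIV) ((\<lambda>\<omega>. \<omega> (Suc n, x)) \<circ> (\<lambda>\<omega>. restrict \<omega> B))"
      by (rule \<Omega>.indep_var_compose) (auto simp: A_def B_def intro!: X_meas comp)
    then have ind: "\<Omega>.indep_var (count_space UNIV) (X n) (count_space UNIV) (\<lambda>\<omega>. \<omega> (Suc n, x))"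
      by (simp add: o_def X_restrict A_def B_def)
    have "measure \<Omega> {\<omega> \<in> space \<Omega>. X n \<omega> = x \<and> \<omega> (Suc n, x) = y}
        = measure \<Omega> (X n -` {x} \<inter> space \<Omega>) * measure \<Omega> ((\<lambda>\<omega>. \<omega> (Suc n, x)) -` {y} \<inter> space \<Omega>)"
      using \<Omega>.indep_varD[OF ind, of "{x}" "{y}"] by (simp add: vimage_def Int_def conj_commute)
    also have "measure \<Omega> (X n -` {x} \<inter> space \<Omega>) = measure (distr \<Omega> (count_space UNIV) (X n)) {x}"
      by (rule measure_distr[symmetric]) (auto simp: X_meas_\<Omega>)
    also have "\<dots> = pmf (\<mu> n) x" by (simp add: law measure_pmf_single)
    also have "(\<lambda>\<omega>. \<omega> (Suc n, x)) -` {y} \<inter> space \<Omega> = {\<omega> \<in> space \<Omega>. \<omega> (Suc n, x) = y}" by auto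
    finally show ?thesis by (simp add: \<Omega>.emeasure_eq_measure single L_def)
  qed
  have law: "distr \<Omega> (count_space UNIV) (X n) = measure_pmf (\<mu> n)" for n
  proof (induction n)
    case 0
    show ?case
    proof (rule measure_eqI_countable[where A = UNIV])
      fix y
      have "X 0 -` {y} \<inter> space \<Omega> = {\<omega> \<in> space \<Omega>. \<omega> (0, undefined) = y}" by (auto simp: X_simps)
      then show "emeasure (distr \<Omega> (count_space UNIV) (X 0)) {y} = emeasure (measure_pmf (\<mu> 0)) {y}"
        by (subst emeasure_distr) (auto simp: X_meas_\<Omega> \<Omega>.emeasure_eq_measure single L_def
            emeasure_pmf_single)
    qed auto
  next
    case (Suc n)
    show ?case unfolding K(1)[symmetric] X_simps(2)[abs_def]
      by (rule discrete_kernel_law(2)) (simp_all add: X_meas_\<Omega> comp_\<Omega> joint[OF Suc])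
  qed
  have step: "AE \<omega> in \<Omega>. R (X n \<omega>) (X (Suc n) \<omega>)" for n
  proof -
    have "AE \<omega> in \<Omega>. X n \<omega> \<in> set_pmf (\<mu> n) \<and> \<omega> (Suc n, X n \<omega>) \<in> set_pmf (K n (X n \<omega>))"
      by (rule discrete_kernel_law(3)) (simp_all add: X_meas_\<Omega> comp_\<Omega> joint[OF law])
    then show ?thesis by (rule AE_mp) (auto simp: X_simps intro!: AE_I2 K(2))
  qed
  show ?thesis
    by (rule that[OF \<Omega>.prob_space_axioms X_meas_\<Omega> law]) (simp add: AE_all_countable step)
qed

section \<open>Random binary trees generated by splitting sizes\<close>

text \<open>A node stands for a non-root vertex of an ordered tree; its left subtree is formed by the descendants
  of that vertex and its right subtree by its later siblings and their descendants.\<close>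

datatype bintree = Lf | Nd bintree bintree

instance bintree :: countable by countable_datatype

fun nodes :: "bintree \<Rightarrow> nat" where
  "nodes Lf = 0"
| "nodes (Nd l r) = Suc (nodes l + nodes r)"

fun height :: "bintree \<Rightarrow> nat" where
  "height Lf = 0"
| "height (Nd l r) = Suc (max (height l) (height r))"

instantiation bintree :: order
begin

fun less_eq_bintree :: "bintree \<Rightarrow> bintree \<Rightarrow> bool" where
  "Lf \<le> t \<longleftrightarrow> True"
| "Nd l r \<le> Lf \<longleftrightarrow> False"
| "Nd l r \<le> Nd l' r' \<longleftrightarrow> l \<le> l' \<and> r \<le> r'"

definition less_bintree :: "bintree \<Rightarrow> bintree \<Rightarrow> bool" where
  "s < t \<longleftrightarrow> s \<le> t \<and> \<not> t \<le> s" for s t :: bintree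

instance
proof
  fix x y z :: bintree
  show "x < y \<longleftrightarrow> x \<le> y \<and> \<not> y \<le> x" by (rule less_bintree_def)
  show "x \<le> x" by (induction x) auto
  show "x \<le> z" if "x \<le> y" "y \<le> z"
    using that
  proof (induction x y arbitrary: z rule: less_eq_bintree.induct)
    case (3 l r l' r')
    then show ?case by (cases z) auto
  qed auto
  show "x = y" if "x \<le> y" "y \<le> x"
    using that by (induction x y rule: less_eq_bintree.induct) (auto elim: less_eq_bintree.elims)
qed

end

lemma height_le_nodes: "height t \<le> nodes t"
  by (induction t) auto

lemma finite_height_le: "finite {t. height t \<le> h}"
proof (induction h)
  case 0
  have "{t. height t \<le> 0} \<subseteq> {Lf}" by (auto elim: height.elims)
  then show ?case by (rule finite_subset) simp
next
  case (Suc h)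
  have "{t. height t \<le> Suc h} \<subseteq> insert Lf ((\<lambda>(l, r). Nd l r) ` ({t. height t \<le> h} \<times> {t. height t \<le> h}))"
  proof
    fix t assume "t \<in> {t. height t \<le> Suc h}"
    then show "t \<in> insert Lf ((\<lambda>(l, r). Nd l r) ` ({t. height t \<le> h} \<times> {t. height t \<le> h}))"
      by (cases t) auto
  qed
  then show ?case by (rule finite_subset) (use Suc in auto)
qed

text \<open>The part of height at most \<open>h\<close> of a random tree with size label \<open>N\<close>: the label 0 belongs to the
  empty tree, and otherwise \<open>W N\<close> is the joint law of the labels of the two subtrees, which are
  independent given their labels. Cutting at a height makes the law discrete even for \<open>N = \<infinity>\<close>.\<close>

fun tree_pmf :: "(enat \<Rightarrow> (enat \<times> enat) pmf) \<Rightarrow> nat \<Rightarrow> enat \<Rightarrow> bintree pmf" where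
  "tree_pmf W 0 N = return_pmf Lf"
| "tree_pmf W (Suc h) N = (if N = 0 then return_pmf Lf else
     bind_pmf (W N) (\<lambda>(L, R). map_pmf (\<lambda>(l, r). Nd l r) (pair_pmf (tree_pmf W h L) (tree_pmf W h R))))"

lemma rel_pmf_Nd:
  assumes "rel_pmf (\<le>) A A'" "rel_pmf (\<le>) B B'"
  shows "rel_pmf (\<le>) (map_pmf (\<lambda>(l, r). Nd l r) (pair_pmf A B)) (map_pmf (\<lambda>(l, r). Nd l r) (pair_pmf A' B'))"
proof -
  have "rel_pmf (rel_prod (\<le>) (\<le>)) (pair_pmf A B) (pair_pmf A' B')"
    using assms by (simp add: rel_pmf_rel_prod)
  then show ?thesis unfolding pmf.rel_map by (rule pmf.rel_mono_strong) auto
qed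

text \<open>Couple the two size pairs monotonically, then the two left subtrees and, independently, the two
  right subtrees by induction.\<close>

lemma tree_pmf_mono:
  assumes W: "\<And>m n. m \<noteq> 0 \<Longrightarrow> m \<le> n \<Longrightarrow> rel_pmf (rel_prod (\<le>) (\<le>)) (W m) (W n)"
    and "m \<le> n"
  shows "rel_pmf (\<le>) (tree_pmf W h m) (tree_pmf W h n)"
  using \<open>m \<le> n\<close>
proof (induction h arbitrary: m n)
  case (Suc h)
  show ?case
  proof (cases "m = 0")
    case True
    then show ?thesis by (simp add: rel_pmf_return_pmf1)
  next
    case False
    moreover from False Suc.prems have "n \<noteq> 0" by auto
    ultimately show ?thesis
      using W[OF False Suc.prems] by (auto intro!: rel_pmf_bindI rel_pmf_Nd Suc.IH)
  qed
qed simp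

lemma set_tree_pmf_nodes:
  assumes W: "\<And>N L R. N \<noteq> 0 \<Longrightarrow> (L, R) \<in> set_pmf (W N) \<Longrightarrow> L + R + 1 = N"
    and "t \<in> set_pmf (tree_pmf W h N)"
  shows "enat (nodes t) \<le> N \<and> min N (enat h) \<le> enat (nodes t) \<and> height t \<le> h"
  using assms(2)
proof (induction h arbitrary: N t)
  case 0
  then show ?case by (simp flip: zero_enat_def)
next
  case (Suc h)
  show ?case
  proof (cases "N = 0")
    case True
    with Suc.prems show ?thesis by (simp flip: zero_enat_def)
  next
    case False
    with Suc.prems obtain L R l r where t: "t = Nd l r" and LR: "(L, R) \<in> set_pmf (W N)"
      and l: "l \<in> set_pmf (tree_pmf W h L)" and r: "r \<in> set_pmf (tree_pmf W h R)" by auto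
    have N: "N = L + R + 1" using W[OF False LR] by simp
    from Suc.IH[OF l] Suc.IH[OF r] show ?thesis
      unfolding N t by (cases L; cases R) (auto simp: one_enat_def)
  qed
qed

text \<open>The law of the size of the left subtree in a uniform binary tree with \<open>n + 1\<close> nodes.\<close>

definition catalan_split :: "nat \<Rightarrow> nat pmf" where
  "catalan_split n = embed_pmf (\<lambda>i. if i \<le> n then catalan i * catalan (n - i) / catalan (Suc n) else 0)"

lemma pmf_catalan_split: "pmf (catalan_split n) i = (if i \<le> n then catalan i * catalan (n - i) / catalan (Suc n) else 0)"
  unfolding catalan_split_def
proof (rule pmf_embed_pmf)
  let ?f = "\<lambda>i. if i \<le> n then catalan i * catalan (n - i) / catalan (Suc n) else 0"
  show nn: "0 \<le> ?f i" for i by (simp del: catalan.simps)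
  have "(\<integral>\<^sup>+ i. ennreal (?f i) \<partial>count_space UNIV) = (\<Sum>i\<le>n. ennreal (?f i))"
    by (rule nn_integral_count_space') auto
  also have "\<dots> = ennreal (\<Sum>i\<le>n. ?f i)" by (rule sum_ennreal) (rule nn)
  also have "(\<Sum>i\<le>n. ?f i) = 1"
    by (simp add: catalan_convolution flip: sum_divide_distrib del: catalan.simps)
  finally show "(\<integral>\<^sup>+ i. ennreal (?f i) \<partial>count_space UNIV) = 1" by simp
qed

lemma set_catalan_split: "i \<in> set_pmf (catalan_split n) \<Longrightarrow> i \<le> n"
  by (auto simp: set_pmf_iff pmf_catalan_split split: if_splits)

text \<open>By log-convexity the point masses satisfy \<open>b j \<le> a j\<close> for \<open>j \<le> n\<close>, where \<open>a\<close> and \<open>b\<close> belong to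
  \<open>n\<close> and \<open>n + 1\<close>, and by symmetry \<open>b (j + 1) \<le> a j\<close>. Summing the former from the left and the
  latter from the right gives the two inequalities between distribution functions.\<close>

lemma catalan_split_step: "rel_pmf (\<lambda>i j. j = i \<or> j = Suc i) (catalan_split n) (catalan_split (Suc n))"
proof (rule rel_pmf_unit_step)
  have ratio: "catalan (Suc m) * catalan (Suc n) \<le> catalan m * catalan (Suc (Suc n))" if "m \<le> n" for m
    using that by (intro catalan_log_convex) simp
  have left: "pmf (catalan_split (Suc n)) j \<le> pmf (catalan_split n) j" if "j \<le> n" for j
  proof -
    have "catalan j * (catalan (Suc (n - j)) * catalan (Suc n)) \<le> catalan j * (catalan (n - j) * catalan (Suc (Suc n)))"
      by (intro mult_left_mono ratio) auto
    then show ?thesis using that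
      by (simp add: pmf_catalan_split Suc_diff_le frac_le_eq divide_le_eq pos_le_divide_eq mult_ac del: catalan.simps)
  qed
  have right: "pmf (catalan_split (Suc n)) (Suc j) \<le> pmf (catalan_split n) j" for j
  proof (cases "j \<le> n")
    case True
    have "(catalan (Suc j) * catalan (Suc n)) * catalan (n - j) \<le> (catalan j * catalan (Suc (Suc n))) * catalan (n - j)"
      by (intro mult_right_mono ratio True) auto
    then show ?thesis using True
      by (simp add: pmf_catalan_split divide_le_eq pos_le_divide_eq mult_ac del: catalan.simps)
  qed (simp add: pmf_catalan_split)
  have total: "(\<Sum>j\<le>i. pmf (catalan_split m) j) = 1" if "m \<le> i" for m i
    using that by (intro sum_pmf_eq_1) (auto dest: set_catalan_split)
  fix i
  show "(\<Sum>j\<le>i. pmf (catalan_split (Suc n)) j) \<le> (\<Sum>j\<le>i. pmf (catalan_split n) j)"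
  proof (cases "i \<le> n")
    case True
    then show ?thesis by (intro sum_mono left) auto
  next
    case False
    have "(\<Sum>j\<le>i. pmf (catalan_split (Suc n)) j) \<le> 1"
      by (simp add: measure_measure_pmf_finite[symmetric])
    then show ?thesis using total[of n i] False by simp
  qed
  show "(\<Sum>j\<le>i. pmf (catalan_split n) j) \<le> (\<Sum>j\<le>Suc i. pmf (catalan_split (Suc n)) j)"
  proof -
    \<comment> \<open>Both sums are complements of tails, which end at \<open>k\<close> and at \<open>k + 1\<close>.\<close>
    define k where "k = max i n"
    have "(\<Sum>j\<in>{Suc i..k}. pmf (catalan_split (Suc n)) (Suc j)) \<le> (\<Sum>j\<in>{Suc i..k}. pmf (catalan_split n) j)"
      by (intro sum_mono right)
    moreover have "(\<Sum>j\<le>k. pmf (catalan_split n) j) = (\<Sum>j\<le>i. pmf (catalan_split n) j) + (\<Sum>j\<in>{Suc i..k}. pmf (catalan_split n) j)"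
      by (subst sum.union_disjoint[symmetric]) (auto simp: k_def intro!: sum.cong)
    moreover have "(\<Sum>j\<le>Suc k. pmf (catalan_split (Suc n)) j)
        = (\<Sum>j\<le>Suc i. pmf (catalan_split (Suc n)) j) + (\<Sum>j\<in>{Suc (Suc i)..Suc k}. pmf (catalan_split (Suc n)) j)"
      by (subst sum.union_disjoint[symmetric]) (auto simp: k_def simp del: sum.atMost_Suc intro!: sum.cong)
    moreover have "(\<Sum>j\<in>{Suc (Suc i)..Suc k}. pmf (catalan_split (Suc n)) j)
        = (\<Sum>j\<in>{Suc i..k}. pmf (catalan_split (Suc n)) (Suc j))"
      by (rule sum.shift_bounds_cl_Suc_ivl)
    moreover have "(\<Sum>j\<le>k. pmf (catalan_split n) j) = 1" "(\<Sum>j\<le>Suc k. pmf (catalan_split (Suc n)) j) = 1"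
      by (rule total, simp add: k_def)+
    ultimately show ?thesis by linarith
  qed
qed

section \<open>Percolation clusters and their sizes\<close>

text \<open>The law of the number of nodes of a percolation cluster: each of the \<open>catalan m\<close> trees with \<open>m\<close>
  nodes is the cluster if its nodes are open and the \<open>m + 1\<close> sites at its boundary are closed.\<close>

definition progeny :: "real \<Rightarrow> enat pmf" where
  "progeny p = embed_pmf (\<lambda>N. case N of enat m \<Rightarrow> catalan m * p ^ m * (1 - p) ^ Suc m | \<infinity> \<Rightarrow> (2 * p - 1) / p)"

text \<open>The law of the sizes of the two subtrees of a cluster given its size. Given an infinite size it is
  that of two independent sizes conditioned on at least one of them being infinite.\<close>

definition size_split :: "real \<Rightarrow> enat \<Rightarrow> (enat \<times> enat) pmf" where
  "size_split p N = (case N of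
      enat n \<Rightarrow> map_pmf (\<lambda>i. (enat i, enat (n - 1 - i))) (catalan_split (n - 1))
    | \<infinity> \<Rightarrow> cond_pmf (pair_pmf (progeny p) (progeny p)) {(L, R). L = \<infinity> \<or> R = \<infinity>})"

lemma size_split_enat_Suc: "size_split p (enat (Suc n)) = map_pmf (\<lambda>i. (enat i, enat (n - i))) (catalan_split n)"
  by (simp add: size_split_def)

context
  fixes p :: real
  assumes p: "1/2 < p" "p \<le> 1"
begin

text \<open>The total mass is 1 since the generating function of the Catalan numbers at \<open>p (1 - p)\<close> is
  \<open>1 / p\<close>, so that a cluster is finite with probability \<open>(1 - p) / p\<close>.\<close>

lemma pmf_progeny: "pmf (progeny p) N = (case N of enat m \<Rightarrow> catalan m * p ^ m * (1 - p) ^ Suc m | \<infinity> \<Rightarrow> (2 * p - 1) / p)"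
  unfolding progeny_def
proof (rule pmf_embed_pmf)
  let ?f = "\<lambda>N. case N of enat m \<Rightarrow> catalan m * p ^ m * (1 - p) ^ Suc m | \<infinity> \<Rightarrow> (2 * p - 1) / p"
  show nn: "0 \<le> ?f N" for N using p by (cases N) auto
  have UNIV: "insert \<infinity> (range enat) = UNIV"
    by auto (metis enat.exhaust rangeI)
  have "(\<lambda>m. (1 - p) * (catalan m * (p * (1 - p)) ^ m)) sums ((1 - p) * (1 / p))"
    by (intro sums_mult catalan_gf_sums p)
  then have "(\<lambda>m. ?f (enat m)) sums ((1 - p) / p)" by (simp add: power_mult_distrib mult_ac)
  then have fin: "(\<Sum>m. ennreal (?f (enat m))) = ennreal ((1 - p) / p)"
    by (intro suminf_ennreal_eq nn)
  have "(\<integral>\<^sup>+ N. ennreal (?f N) \<partial>count_space UNIV)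
      = (\<integral>\<^sup>+ N. ennreal (?f N) \<partial>count_space (range enat)) + (\<integral>\<^sup>+ N. ennreal (?f N) \<partial>count_space {\<infinity>})"
    using nn_integral_disjoint_pair_countspace[of "range enat" "{\<infinity>}" "\<lambda>N. ennreal (?f N)"]
    by (simp add: nn_integral_count_space_indicator UNIV image_iff)
  also have "(\<integral>\<^sup>+ N. ennreal (?f N) \<partial>count_space (range enat)) = (\<integral>\<^sup>+ m. ennreal (?f (enat m)) \<partial>count_space UNIV)"
    by (rule nn_integral_bij_count_space[symmetric]) (auto simp: bij_betw_def inj_on_def)
  also have "\<dots> = ennreal ((1 - p) / p)" unfolding nn_integral_count_space_nat by (rule fin)
  also have "(\<integral>\<^sup>+ N. ennreal (?f N) \<partial>count_space {\<infinity>}) = ennreal ((2 * p - 1) / p)"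
    by (subst nn_integral_count_space_finite) auto
  also have "ennreal ((1 - p) / p) + ennreal ((2 * p - 1) / p) = ennreal ((1 - p) / p + (2 * p - 1) / p)"
    using p by (intro ennreal_plus[symmetric]) auto
  also have "(1 - p) / p + (2 * p - 1) / p = 1" using p by (simp add: field_simps)
  finally show "(\<integral>\<^sup>+ N. ennreal (?f N) \<partial>count_space UNIV) = 1" by simp
qed

lemma infinity_in_set_progeny: "\<infinity> \<in> set_pmf (progeny p)"
  using p by (simp add: set_pmf_iff pmf_progeny)

lemma size_split_infinity_nonempty:
  "set_pmf (pair_pmf (progeny p) (progeny p)) \<inter> {(L, R). L = \<infinity> \<or> R = \<infinity>} \<noteq> {}"
  using infinity_in_set_progeny by auto

lemma pmf_size_split_infinity:
  "pmf (size_split p \<infinity>) (L, R)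
    = (if L = \<infinity> \<or> R = \<infinity> then pmf (progeny p) L * pmf (progeny p) R * (p\<^sup>2 / (2 * p - 1)) else 0)"
proof -
  let ?P = "pair_pmf (progeny p) (progeny p)"
  have "{(L, R). L = \<infinity> \<or> R = \<infinity>} = space ?P - (- {\<infinity>}) \<times> (- {\<infinity> :: enat})" by auto
  then have "measure ?P {(L, R). L = \<infinity> \<or> R = \<infinity>} = 1 - measure ?P ((- {\<infinity>}) \<times> (- {\<infinity>}))"
    by (simp add: measure_pmf.prob_compl del: space_measure_pmf)
  also have "measure ?P ((- {\<infinity>}) \<times> (- {\<infinity>})) = (measure (progeny p) (- {\<infinity>}))\<^sup>2"
    by (subst measure_pmf_prob_product) (auto simp: power2_eq_square)
  also have "measure (progeny p) (- {\<infinity>}) = (1 - p) / p"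
    using measure_pmf.prob_compl[of "{\<infinity>}" "progeny p"] p
    by (simp add: measure_pmf_single pmf_progeny Compl_eq_Diff_UNIV field_simps)
  also have "1 - ((1 - p) / p)\<^sup>2 = (2 * p - 1) / p\<^sup>2"
    using p by (simp add: field_simps power2_eq_square)
  finally show ?thesis
    by (simp add: size_split_def pmf_cond[OF size_split_infinity_nonempty] pmf_pair)
qed

lemma set_size_split: "N \<noteq> 0 \<Longrightarrow> (L, R) \<in> set_pmf (size_split p N) \<Longrightarrow> L + R + 1 = N"
proof (cases N)
  case (enat n)
  assume "N \<noteq> 0" "(L, R) \<in> set_pmf (size_split p N)"
  with enat show ?thesis
    by (cases n) (auto simp: size_split_enat_Suc one_enat_def zero_enat_def dest!: set_catalan_split)
next
  case infinity
  assume "(L, R) \<in> set_pmf (size_split p N)"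
  then have "L = \<infinity> \<or> R = \<infinity>"
    using infinity by (simp add: set_pmf_iff pmf_size_split_infinity split: if_splits)
  then show ?thesis using infinity by auto
qed

text \<open>Bayes' rule: sizes \<open>L\<close> and \<open>R\<close> below an open top node can be drawn directly, or by drawing the total
  size first.\<close>

lemma pmf_size_split_mult:
  "pmf (size_split p (L + R + 1)) (L, R) * pmf (progeny p) (L + R + 1) = p * (pmf (progeny p) L * pmf (progeny p) R)"
proof (cases "L = \<infinity> \<or> R = \<infinity>")
  case True
  then have "L + R + 1 = \<infinity>" by auto
  then show ?thesis using True p by (simp add: pmf_size_split_infinity pmf_progeny[of \<infinity>] power2_eq_square)
next
  case False
  then obtain i j where ij: "L = enat i" "R = enat j" by (cases L; cases R) auto
  then have N: "L + R + 1 = enat (Suc (i + j))" by (simp add: one_enat_def)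
  have "pmf (size_split p (L + R + 1)) (L, R)
      = pmf (map_pmf (\<lambda>i'. (enat i', enat (i + j - i'))) (catalan_split (i + j))) (enat i, enat (i + j - i))"
    unfolding N size_split_enat_Suc by (simp add: ij)
  also have "\<dots> = pmf (catalan_split (i + j)) i"
    by (rule pmf_map_inj'[where f = "\<lambda>i'. (enat i', enat (i + j - i'))"]) (auto simp: inj_on_def)
  also have "\<dots> = catalan i * catalan j / catalan (Suc (i + j))" by (simp add: pmf_catalan_split del: catalan.simps)
  finally show ?thesis unfolding N
    by (simp add: ij pmf_progeny power_add del: catalan.simps)
qed

text \<open>The targets in \<open>G\<close>, whose finite entry is at most \<open>n\<close>, are matched with the source that agrees with
  them in that entry; both \<open>(m, \<infinity>)\<close> and \<open>(\<infinity>, m)\<close> have mass \<open>w m\<close>. The source \<open>(i, n - i)\<close> thus receives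
  \<open>w i + w (n - i)\<close>. Since \<open>p (1 - p) \<le> 1 / 4\<close>, \<open>inverse_catalan_superadditive\<close> shows
  that this is at most its own mass.\<close>

lemma size_split_infinity_dominates:
  "rel_pmf (rel_prod (\<le>) (\<le>)) (size_split p (enat (Suc n))) (size_split p \<infinity>)"
  unfolding size_split_enat_Suc pmf.rel_map
proof (rule rel_pmf_overlap)
  define G where "G = (\<lambda>m. (enat m, \<infinity>)) ` {..n} \<union> (\<lambda>m. (\<infinity>, enat m)) ` {..n}"
  define g where "g = (\<lambda>(L, R). if R = \<infinity> then the_enat L else n - the_enat R)"
  define w where "w m = catalan m * (p * (1 - p)) ^ Suc m" for m
  have w: "pmf (size_split p \<infinity>) (enat m, \<infinity>) = w m" "pmf (size_split p \<infinity>) (\<infinity>, enat m) = w m" for m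
    using p by (simp_all add: pmf_size_split_infinity pmf_progeny w_def power_mult_distrib power2_eq_square)
  show "measure (size_split p \<infinity>) {y \<in> G. g y = i} \<le> pmf (catalan_split n) i" for i
  proof (cases "i \<le> n")
    case False
    then have "{y \<in> G. g y = i} = {}" by (auto simp: G_def g_def)
    then show ?thesis by (simp only: measure_empty pmf_nonneg)
  next
    case True
    then have "{y \<in> G. g y = i} = {(enat i, \<infinity>), (\<infinity>, enat (n - i))}"
      by (auto simp: G_def g_def)
    then have "measure (size_split p \<infinity>) {y \<in> G. g y = i} = w i + w (n - i)"
      by (simp add: measure_measure_pmf_finite w)
    also have "\<dots> \<le> catalan i / 4 ^ Suc i + catalan (n - i) / 4 ^ Suc (n - i)"
    proof -
      have "p * (1 - p) = 1 / 4 - (p - 1 / 2)\<^sup>2" by (simp add: power2_eq_square algebra_simps)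
      then have "p * (1 - p) \<le> 1 / 4" by simp
      then have "(p * (1 - p)) ^ k \<le> (1 / 4) ^ k" for k using p by (intro power_mono) auto
      then have "w m \<le> catalan m / 4 ^ Suc m" for m
        using mult_left_mono[of "(p * (1 - p)) ^ Suc m" "(1 / 4) ^ Suc m" "catalan m"]
        by (simp add: w_def power_one_over field_simps del: power_Suc)
      then show ?thesis by (intro add_mono)
    qed
    also have "\<dots> \<le> catalan i * catalan (n - i) / catalan (Suc n)"
    proof -
      have "(4 ^ i / catalan i + 4 ^ (n - i) / catalan (n - i)) * (catalan i * catalan (n - i) / 4 ^ Suc n)
          \<le> (4 ^ Suc n / catalan (Suc n)) * (catalan i * catalan (n - i) / 4 ^ Suc n)"
        using inverse_catalan_superadditive[of i "n - i"] True
        by (intro mult_right_mono) (auto simp del: catalan.simps)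
      moreover have "(4 ^ i / catalan i + 4 ^ (n - i) / catalan (n - i)) * (catalan i * catalan (n - i) / 4 ^ Suc n)
          = catalan i / 4 ^ Suc i + catalan (n - i) / 4 ^ Suc (n - i)"
      proof -
        have "(4 :: real) ^ n = 4 ^ i * 4 ^ (n - i)" using True by (simp flip: power_add)
        then show ?thesis by (simp add: field_simps)
      qed
      ultimately show ?thesis by (simp del: catalan.simps)
    qed
    finally show ?thesis using True by (simp add: pmf_catalan_split)
  qed
  have supp: "L = \<infinity> \<or> R = \<infinity>" if "(L, R) \<in> set_pmf (size_split p \<infinity>)" for L R
    using that by (simp add: set_pmf_iff pmf_size_split_infinity split: if_splits)
  have "(\<infinity>, \<infinity>) \<in> set_pmf (size_split p \<infinity>)"
    using p by (simp add: set_pmf_iff pmf_size_split_infinity pmf_progeny)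
  then show "\<not> set_pmf (size_split p \<infinity>) \<subseteq> G" by (auto simp: G_def)
  show "rel_prod (\<le>) (\<le>) (enat (g y), enat (n - g y)) y" if "y \<in> G" for y
    using that by (auto simp: G_def g_def)
  show "rel_prod (\<le>) (\<le>) (enat i, enat (n - i)) y"
    if "i \<in> set_pmf (catalan_split n)" "y \<in> set_pmf (size_split p \<infinity>)" "y \<notin> G" for i y
  proof -
    obtain L R where y: "y = (L, R)" by fastforce
    from supp that(2) have "L = \<infinity> \<or> R = \<infinity>" by (simp add: y)
    then show ?thesis using that(3) set_catalan_split[OF that(1)] unfolding y
      by (cases L; cases R) (auto simp: G_def)
  qed
qed

lemma size_split_step: "rel_pmf (rel_prod (\<le>) (\<le>)) (size_split p (enat (Suc n))) (size_split p (enat (Suc (Suc n))))"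
  unfolding size_split_enat_Suc pmf.rel_map by (rule pmf.rel_mono_strong[OF catalan_split_step]) auto

text \<open>Single steps compose to arbitrary finite sizes because the order on pairs is transitive.\<close>

lemma size_split_mono:
  assumes "m \<noteq> 0" "m \<le> N"
  shows "rel_pmf (rel_prod (\<le>) (\<le>)) (size_split p m) (size_split p N)"
proof (cases m)
  case infinity
  with assms show ?thesis by (simp add: rel_pmf_reflI prod.rel_refl)
next
  case (enat k)
  with assms obtain n where m: "m = enat (Suc n)" by (cases k) (auto simp: zero_enat_def)
  show ?thesis
  proof (cases N)
    case infinity
    then show ?thesis unfolding m by (simp add: size_split_infinity_dominates)
  next
    case (enat l)
    with m assms have "Suc n \<le> l" by simp
    then show ?thesis unfolding m enat
    proof (induction l rule: dec_induct)
      case base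
      show ?case by (rule rel_pmf_reflI) (simp add: prod.rel_refl)
    next
      case (step l)
      then obtain l' where l: "l = Suc l'" by (cases l) auto
      have "transp (rel_prod (\<le>) (\<le>) :: enat \<times> enat \<Rightarrow> _)"
        by (rule transpI) (auto elim!: rel_prod.cases)
      with step.IH size_split_step[of l'] show ?case unfolding l by (rule rel_pmf_trans)
    qed
  qed
qed

text \<open>The law of the part of height at most \<open>h\<close> of a percolation cluster, obtained by drawing its size
  first.\<close>

definition cluster_pmf :: "nat \<Rightarrow> bintree pmf" where
  "cluster_pmf h = bind_pmf (progeny p) (tree_pmf (size_split p) h)"

text \<open>Drawing the total size and then splitting it is the same as opening the top node with probability
  \<open>p\<close> and drawing two independent sizes below it.\<close>

lemma progeny_size_split:
  "bind_pmf (progeny p) (\<lambda>N. if N = 0 then return_pmf None else map_pmf Some (size_split p N))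
    = bind_pmf (bernoulli_pmf p) (\<lambda>b. if b then map_pmf Some (pair_pmf (progeny p) (progeny p)) else return_pmf None)"
  (is "?l = ?r")
proof (rule pmf_eqI)
  fix z
  have Some: "pmf (map_pmf Some q) (Some x) = pmf q x" for q :: "(enat \<times> enat) pmf" and x
    by (rule pmf_map_inj') simp
  have None: "pmf (map_pmf Some q) None = 0" for q :: "(enat \<times> enat) pmf"
    by (rule pmf_map_outside) auto
  show "pmf ?l z = pmf ?r z"
  proof (cases z)
    case None': None
    have "pmf ?l z = (\<Sum>N\<in>{0}. pmf (if N = 0 then return_pmf None else map_pmf Some (size_split p N)) z * pmf (progeny p) N)"
      unfolding pmf_bind by (rule integral_measure_pmf_real) (auto simp: None' None split: if_splits)
    then show ?thesis using p by (simp add: None' None pmf_bind pmf_progeny zero_enat_def)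
  next
    case Some': (Some x)
    obtain L R where x: "x = (L, R)" by fastforce
    have "pmf ?l z = (\<Sum>N\<in>{L + R + 1}. pmf (if N = 0 then return_pmf None else map_pmf Some (size_split p N)) z * pmf (progeny p) N)"
      unfolding pmf_bind
      by (rule integral_measure_pmf_real) (auto simp: Some' Some x set_size_split set_pmf_iff[symmetric] split: if_splits)
    also have "\<dots> = p * (pmf (progeny p) L * pmf (progeny p) R)"
      using pmf_size_split_mult[of L R] by (simp add: Some' Some x)
    finally show ?thesis using p by (simp add: Some' Some x pmf_bind pmf_pair)
  qed
qed

lemma cluster_pmf_0: "cluster_pmf 0 = return_pmf Lf"
  by (simp add: cluster_pmf_def tree_pmf.simps(1)[abs_def])

lemma cluster_pmf_Suc:
  "cluster_pmf (Suc h) = bind_pmf (bernoulli_pmf p) (\<lambda>b. if b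
     then map_pmf (\<lambda>(l, r). Nd l r) (pair_pmf (cluster_pmf h) (cluster_pmf h)) else return_pmf Lf)"
proof -
  define F where "F = (\<lambda>(L, R). map_pmf (\<lambda>(l, r). Nd l r) (pair_pmf (tree_pmf (size_split p) h L) (tree_pmf (size_split p) h R)))"
  define D where "D = case_option (return_pmf Lf) F"
  have "cluster_pmf (Suc h) = bind_pmf (bind_pmf (progeny p)
      (\<lambda>N. if N = 0 then return_pmf None else map_pmf Some (size_split p N))) D"
    unfolding cluster_pmf_def bind_assoc_pmf
    by (intro bind_pmf_cong refl) (auto simp: F_def[symmetric] D_def bind_map_pmf bind_return_pmf o_def)
  also have "\<dots> = bind_pmf (bernoulli_pmf p) (\<lambda>b. if b then bind_pmf (pair_pmf (progeny p) (progeny p)) F else return_pmf Lf)"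
    unfolding progeny_size_split bind_assoc_pmf
    by (intro bind_pmf_cong refl) (auto simp: D_def bind_map_pmf bind_return_pmf o_def)
  also have "bind_pmf (pair_pmf (progeny p) (progeny p)) F = map_pmf (\<lambda>(l, r). Nd l r) (pair_pmf (cluster_pmf h) (cluster_pmf h))"
    by (simp add: F_def cluster_pmf_def pair_bind_pmf map_bind_pmf case_prod_unfold)
  finally show ?thesis .
qed

text \<open>A cluster contains a given tree iff all nodes of that tree are open.\<close>

lemma cluster_pmf_cone: "height t \<le> h \<Longrightarrow> measure (cluster_pmf h) {s. t \<le> s} = p ^ nodes t"
proof (induction h arbitrary: t)
  case 0
  then show ?case by (cases t) (auto simp: cluster_pmf_0)
next
  case (Suc h)
  show ?case
  proof (cases t)
    case Lf
    then show ?thesis by simp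
  next
    case (Nd l r)
    have "measure (cluster_pmf (Suc h)) {s. t \<le> s}
        = (\<integral>b. (if b then measure (pair_pmf (cluster_pmf h) (cluster_pmf h)) ({s. l \<le> s} \<times> {s. r \<le> s}) else 0) \<partial>bernoulli_pmf p)"
      unfolding cluster_pmf_Suc measure_bind_pmf
      by (intro Bochner_Integration.integral_cong refl)
        (auto simp: Nd intro!: arg_cong[where f = "measure _"])
    also have "\<dots> = p * (measure (cluster_pmf h) {s. l \<le> s} * measure (cluster_pmf h) {s. r \<le> s})"
      using p by (simp add: measure_pmf_prob_product)
    finally show ?thesis using Suc by (simp add: Nd power_add)
  qed
qed

end

text \<open>For a finite size and a sufficient height the recursive construction is the uniform distribution:
  the factors \<open>catalan i * catalan j / catalan (i + j + 1)\<close> of the successive splits telescope.\<close>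

lemma pmf_tree_pmf_enat:
  assumes "n \<le> h"
  shows "pmf (tree_pmf (size_split p) h (enat n)) t = (if nodes t = n then 1 / catalan n else 0)"
  using assms
proof (induction h arbitrary: n t)
  case 0
  then show ?case by (cases t) (auto simp: pmf_return)
next
  case (Suc h)
  show ?case
  proof (cases n)
    case 0
    then show ?thesis by (cases t) (auto simp: zero_enat_def[symmetric] pmf_return)
  next
    case n: (Suc m)
    define F where "F = (\<lambda>i. map_pmf (\<lambda>(l, r). Nd l r)
      (pair_pmf (tree_pmf (size_split p) h (enat i)) (tree_pmf (size_split p) h (enat (m - i)))))"
    have tree_pmf: "tree_pmf (size_split p) (Suc h) (enat n) = bind_pmf (catalan_split m) F"
      by (simp add: n size_split_enat_Suc bind_map_pmf zero_enat_def F_def)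
    show ?thesis
    proof (cases t)
      case Lf
      have "Lf \<notin> set_pmf (bind_pmf (catalan_split m) F)" by (auto simp: F_def)
      then show ?thesis unfolding tree_pmf Lf by (simp add: n set_pmf_iff del: set_bind_pmf)
    next
      case (Nd l r)
      have F: "pmf (F i) t = (if i = nodes l \<and> m - i = nodes r then 1 / (catalan i * catalan (m - i)) else 0)"
        if "i \<le> m" for i
      proof -
        have "pmf (F i) (case (l, r) of (l, r) \<Rightarrow> Nd l r)
            = pmf (tree_pmf (size_split p) h (enat i)) l * pmf (tree_pmf (size_split p) h (enat (m - i))) r"
          unfolding F_def by (subst pmf_map_inj') (auto simp: inj_on_def pmf_pair)
        then show ?thesis using Suc.prems that n
          by (auto simp: Nd Suc.IH)
      qed
      have "pmf (bind_pmf (catalan_split m) F) t = (\<Sum>i\<in>{nodes l}. pmf (F i) t * pmf (catalan_split m) i)"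
        unfolding pmf_bind
        by (rule integral_measure_pmf_real) (auto dest!: set_catalan_split simp: F split: if_splits)
      then show ?thesis
        unfolding tree_pmf by (cases "nodes l \<le> m") (auto simp: F[unfolded Nd] Nd n pmf_catalan_split simp del: catalan.simps)
    qed
  qed
qed

section \<open>Ordered trees as binary trees\<close>

text \<open>The two parts of a set of non-root vertices other than \<open>[1]\<close> that correspond to the subtrees of a
  binary tree: the proper descendants of \<open>[1]\<close>, and the later siblings of \<open>[1]\<close> with their
  descendants, with the first coordinate lowered by one.\<close>

definition left_part :: "vertex set \<Rightarrow> vertex set" where
  "left_part V = {v. v \<noteq> [] \<and> 1 # v \<in> V}"

definition right_part :: "vertex set \<Rightarrow> vertex set" where
  "right_part V = {i # w | i w. 1 \<le> i \<and> Suc i # w \<in> V}"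

fun nonroot :: "bintree \<Rightarrow> vertex set" where
  "nonroot Lf = {}"
| "nonroot (Nd l r) = insert [1] (Cons 1 ` nonroot l \<union> (\<lambda>v. Suc (hd v) # tl v) ` nonroot r)"

text \<open>The binary tree of a set of non-root vertices, cut at height \<open>h\<close> so that it is defined for infinite
  sets as well.\<close>

fun trunc :: "nat \<Rightarrow> vertex set \<Rightarrow> bintree" where
  "trunc 0 V = Lf"
| "trunc (Suc h) V = (if [1] \<in> V then Nd (trunc h (left_part V)) (trunc h (right_part V)) else Lf)"

definition ordered_tree_of :: "bintree \<Rightarrow> vertex set" where
  "ordered_tree_of t = insert [] (nonroot t)"

text \<open>The non-root part of an ordered tree, characterised by closure under parents and preceding siblings
  instead of by connectedness; see \<open>ordered_trees_iff\<close>.\<close>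

definition below_root :: "vertex set \<Rightarrow> bool" where
  "below_root V \<longleftrightarrow> V \<subseteq> verts - {[]} \<and>
     (\<forall>v i. v @ [i] \<in> V \<longrightarrow> (v = [] \<or> v \<in> V) \<and> (2 \<le> i \<longrightarrow> v @ [i - 1] \<in> V))"

lemma Nil_notin_nonroot [simp]: "[] \<notin> nonroot t"
  by (cases t) auto

lemma nonroot_subset_verts: "nonroot t \<subseteq> verts"
proof (induction t)
  case (Nd l r)
  have "Suc (hd v) # tl v \<in> verts" if "v \<in> nonroot r" for v
    using that Nd by (cases v) (auto simp: verts_def subset_iff)
  then show ?case using Nd by (auto simp: verts_def subset_iff)
qed simp

lemma nonroot_Cons: "v \<in> nonroot t \<Longrightarrow> \<exists>i w. v = Suc i # w"
proof (cases v)
  case (Cons a w)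
  moreover assume "v \<in> nonroot t"
  ultimately have "1 \<le> a" using nonroot_subset_verts[of t] by (auto simp: verts_def)
  with Cons show ?thesis by (cases a) auto
qed simp

lemma one_in_nonroot_Nd [simp]: "[Suc 0] \<in> nonroot (Nd l r)"
  by simp

lemma left_part_nonroot: "left_part (nonroot (Nd l r)) = nonroot l"
proof -
  have "v \<noteq> [] \<and> 1 # v \<in> nonroot (Nd l r) \<longleftrightarrow> v \<in> nonroot l" for v
    by (auto dest: nonroot_Cons)
  then show ?thesis unfolding left_part_def by blast
qed

lemma right_part_nonroot: "right_part (nonroot (Nd l r)) = nonroot r"
proof -
  have iff: "Suc i # w \<in> nonroot (Nd l r) \<longleftrightarrow> i # w \<in> nonroot r" if "1 \<le> i" for i w
  proof
    assume "Suc i # w \<in> nonroot (Nd l r)"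
    with that obtain u where u: "u \<in> nonroot r" "i = hd u" "w = tl u" by auto
    moreover obtain j u' where "u = Suc j # u'" using nonroot_Cons[OF u(1)] by blast
    ultimately have "u = i # w" by simp
    then show "i # w \<in> nonroot r" using u(1) by (simp only:)
  next
    assume "i # w \<in> nonroot r"
    then have "(\<lambda>v. Suc (hd v) # tl v) (i # w) \<in> (\<lambda>v. Suc (hd v) # tl v) ` nonroot r" by (rule imageI)
    then show "Suc i # w \<in> nonroot (Nd l r)" by simp
  qed
  show ?thesis
  proof (rule set_eqI)
    fix v
    show "v \<in> right_part (nonroot (Nd l r)) \<longleftrightarrow> v \<in> nonroot r"
      using nonroot_Cons[of v r] unfolding right_part_def by (auto simp: iff simp del: nonroot.simps(2))
  qed
qed

lemma nonroot_Nd_subset_iff: "nonroot (Nd l r) \<subseteq> V \<longleftrightarrow> [1] \<in> V \<and> nonroot l \<subseteq> left_part V \<and> nonroot r \<subseteq> right_part V"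
proof -
  have "Suc (hd v) # tl v \<in> V \<longleftrightarrow> v \<in> right_part V" if "v \<in> nonroot r" for v
    using that nonroot_subset_verts[of r] by (cases v) (auto simp: verts_def right_part_def)
  moreover have "1 # v \<in> V \<longleftrightarrow> v \<in> left_part V" if "v \<in> nonroot l" for v
    using that by (auto simp: left_part_def)
  ultimately show ?thesis by auto
qed

lemma height_trunc: "height (trunc h V) \<le> h"
  by (induction h arbitrary: V) auto

text \<open>The truncation is the largest binary tree of height at most \<open>h\<close> contained in \<open>V\<close>. This turns
  inclusion in a possibly infinite vertex set into a comparison of finite trees.\<close>

lemma nonroot_subset_iff: "height t \<le> h \<Longrightarrow> nonroot t \<subseteq> V \<longleftrightarrow> t \<le> trunc h V"
proof (induction t arbitrary: h V)
  case (Nd l r)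
  then obtain h' where h: "h = Suc h'" "height l \<le> h'" "height r \<le> h'" by (cases h) auto
  show ?case
    unfolding nonroot_Nd_subset_iff using Nd.IH(1)[OF h(2), of "left_part V"] Nd.IH(2)[OF h(3), of "right_part V"]
    by (auto simp: h(1))
qed simp

lemma nonroot_trunc_subset: "nonroot (trunc h V) \<subseteq> V"
  by (simp add: nonroot_subset_iff[OF height_trunc])

lemma trunc_nonroot: "height t \<le> h \<Longrightarrow> trunc h (nonroot t) = t"
proof (induction h arbitrary: t)
  case 0
  then show ?case by (cases t) auto
next
  case (Suc h)
  then show ?case by (cases t) (auto simp: left_part_nonroot right_part_nonroot simp del: nonroot.simps(2))
qed

lemma nonroot_subset_nonroot_iff: "nonroot s \<subseteq> nonroot t \<longleftrightarrow> s \<le> t"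
  using nonroot_subset_iff[of s "max (height s) (height t)" "nonroot t"] by (simp add: trunc_nonroot)

lemma inj_nonroot: "inj nonroot"
proof (rule injI)
  fix s t assume "nonroot s = nonroot t"
  then have "s \<le> t" "t \<le> s" by (simp_all flip: nonroot_subset_nonroot_iff)
  then show "s = t" by simp
qed

lemma trunc_nonroot_trunc: "h \<le> H \<Longrightarrow> trunc h (nonroot (trunc H V)) = trunc h V"
proof (induction h arbitrary: H V)
  case (Suc h)
  then obtain H' where "H = Suc H'" "h \<le> H'" by (cases H) auto
  then show ?case using Suc.IH[of H'] by (auto simp: left_part_nonroot right_part_nonroot simp del: nonroot.simps(2))
qed simp

lemma finite_nonroot [simp]: "finite (nonroot t)"
  by (induction t) auto

lemma card_nonroot: "card (nonroot t) = nodes t"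
proof (induction t)
  case (Nd l r)
  have hd: "\<exists>i w. v = i # w \<and> 1 \<le> i" if "v \<in> nonroot r" for v
    using that nonroot_subset_verts[of r] by (cases v) (auto simp: verts_def)
  have "inj_on (\<lambda>v. Suc (hd v) # tl v) (nonroot r)"
    by (rule inj_onI) (auto dest!: hd)
  then have "card ((\<lambda>v. Suc (hd v) # tl v) ` nonroot r) = nodes r" using Nd by (simp add: card_image)
  moreover have "card (Cons 1 ` nonroot l) = nodes l" using Nd by (simp add: card_image)
  moreover have "Cons 1 ` nonroot l \<inter> (\<lambda>v. Suc (hd v) # tl v) ` nonroot r = {}"
    by (auto dest!: hd)
  moreover have "[1] \<notin> Cons 1 ` nonroot l \<union> (\<lambda>v. Suc (hd v) # tl v) ` nonroot r"
    by (auto dest!: hd)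
  ultimately show ?case by (simp add: card_Un_disjoint)
qed simp

lemma below_root_left_part: "below_root V \<Longrightarrow> below_root (left_part V)"
  unfolding below_root_def left_part_def
  by (auto simp: verts_def subset_iff simp flip: append_Cons)

lemma below_root_right_part:
  assumes V: "below_root V"
  shows "below_root (right_part V)"
  unfolding below_root_def
proof (intro conjI allI impI)
  show "right_part V \<subseteq> verts - {[]}"
    using V by (auto simp: below_root_def right_part_def verts_def subset_iff)
  fix v i assume vi: "v @ [i] \<in> right_part V"
  have cl: "(u = [] \<or> u \<in> V) \<and> (2 \<le> j \<longrightarrow> u @ [j - 1] \<in> V)" if "u @ [j] \<in> V" for u j
    using V that by (auto simp: below_root_def)
  show "v = [] \<or> v \<in> right_part V" "2 \<le> i \<Longrightarrow> v @ [i - 1] \<in> right_part V"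
  proof (atomize (full), cases v)
    case Nil
    then show "(v = [] \<or> v \<in> right_part V) \<and> (2 \<le> i \<longrightarrow> v @ [i - 1] \<in> right_part V)"
      using vi cl[of "[]" "Suc i"] by (auto simp: right_part_def)
  next
    case (Cons j w)
    then show "(v = [] \<or> v \<in> right_part V) \<and> (2 \<le> i \<longrightarrow> v @ [i - 1] \<in> right_part V)"
      using vi cl[of "Suc j # w" i] by (auto simp: right_part_def)
  qed
qed

lemma below_root_first:
  assumes V: "below_root V" and v: "v \<in> V"
  shows "[1] \<in> V"
proof -
  have "v \<noteq> []" using V v by (auto simp: below_root_def)
  with v have "[hd v] \<in> V"
  proof (induction v rule: rev_induct)
    case (snoc i v)
    then show ?case using V by (cases "v = []") (auto simp: below_root_def)
  qed simp
  moreover have "[Suc i] \<in> V \<Longrightarrow> [1] \<in> V" for i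
  proof (induction i)
    case (Suc i)
    then have "[] @ [Suc (Suc i)] \<in> V" by simp
    then have "[] @ [Suc (Suc i) - 1] \<in> V" using V unfolding below_root_def by fastforce
    then show ?case using Suc.IH by simp
  qed simp
  moreover have "[0] \<notin> V" using V by (auto simp: below_root_def verts_def subset_iff)
  ultimately show ?thesis by (cases "hd v") auto
qed

lemma below_root_decompose:
  assumes "below_root V" "V \<noteq> {}"
  shows "V = insert [1] (Cons 1 ` left_part V \<union> (\<lambda>v. Suc (hd v) # tl v) ` right_part V)" (is "V = ?W")
proof
  show "V \<subseteq> ?W"
  proof
    fix v assume v: "v \<in> V"
    with assms(1) have "v \<in> verts" "v \<noteq> []" by (auto simp: below_root_def)
    then obtain i w where iw: "v = i # w" "1 \<le> i" by (cases v) (auto simp: verts_def)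
    show "v \<in> ?W"
    proof (cases "i = 1")
      case True
      then show ?thesis using v iw by (auto simp: left_part_def)
    next
      case False
      then obtain j where "i = Suc j" "1 \<le> j" using iw by (cases i) auto
      then have "j # w \<in> right_part V" using v iw by (auto simp: right_part_def)
      then have "Suc (hd (j # w)) # tl (j # w) \<in> (\<lambda>v. Suc (hd v) # tl v) ` right_part V" by (rule imageI)
      then show ?thesis using iw \<open>i = Suc j\<close> by simp
    qed
  qed
  show "?W \<subseteq> V" using below_root_first[OF assms(1)] assms(2) by (auto simp: left_part_def right_part_def)
qed

text \<open>A truncation with fewer than \<open>h\<close> nodes cannot have reached the height \<open>h\<close>, so nothing was cut off.\<close>

lemma nonroot_trunc_eq: "below_root V \<Longrightarrow> nodes (trunc h V) < h \<Longrightarrow> nonroot (trunc h V) = V"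
proof (induction h arbitrary: V)
  case (Suc h)
  show ?case
  proof (cases "V = {}")
    case False
    then have "[1] \<in> V" using below_root_first Suc.prems(1) by blast
    with Suc.prems have "nonroot (trunc h (left_part V)) = left_part V" "nonroot (trunc h (right_part V)) = right_part V"
      by (auto intro!: Suc.IH below_root_left_part below_root_right_part)
    with \<open>[1] \<in> V\<close> have "nonroot (trunc (Suc h) V)
        = insert [1] (Cons 1 ` left_part V \<union> (\<lambda>v. Suc (hd v) # tl v) ` right_part V)" by simp
    also have "\<dots> = V" by (rule below_root_decompose[OF Suc.prems(1) False, symmetric])
    finally show ?thesis .
  qed simp
qed simp

lemma nodes_trunc_eq_iff:
  assumes "below_root V" "m < h"
  shows "nodes (trunc h V) = m \<longleftrightarrow> finite V \<and> card V = m"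
proof
  assume "nodes (trunc h V) = m"
  with assms have "nonroot (trunc h V) = V" by (intro nonroot_trunc_eq) auto
  with \<open>nodes (trunc h V) = m\<close> show "finite V \<and> card V = m" by (metis card_nonroot finite_nonroot)
next
  assume fin: "finite V \<and> card V = m"
  then have "nodes (trunc h V) \<le> m"
    using card_mono[OF _ nonroot_trunc_subset] by (auto simp: card_nonroot)
  with assms have "nonroot (trunc h V) = V" by (intro nonroot_trunc_eq) auto
  with fin show "nodes (trunc h V) = m" by (metis card_nonroot)
qed

lemma below_root_nonroot: "below_root (nonroot t)"
proof (induction t)
  case Lf
  then show ?case by (simp add: below_root_def)
next
  case (Nd l r)
  have L: "(v = [] \<or> v \<in> nonroot l) \<and> (2 \<le> i \<longrightarrow> v @ [i - 1] \<in> nonroot l)" if "v @ [i] \<in> nonroot l" for v i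
    using Nd(1) that by (auto simp: below_root_def)
  have R: "(v = [] \<or> v \<in> nonroot r) \<and> (2 \<le> i \<longrightarrow> v @ [i - 1] \<in> nonroot r)" if "v @ [i] \<in> nonroot r" for v i
    using Nd(2) that by (auto simp: below_root_def)
  show ?case
    unfolding below_root_def
  proof (intro conjI allI impI)
    show "nonroot (Nd l r) \<subseteq> verts - {[]}" using nonroot_subset_verts[of "Nd l r"] Nil_notin_nonroot[of "Nd l r"] by blast
    fix v i assume vi: "v @ [i] \<in> nonroot (Nd l r)"
    then consider "v = []" "i = 1" | w where "v @ [i] = 1 # w" "w \<in> nonroot l"
      | w where "v @ [i] = Suc (hd w) # tl w" "w \<in> nonroot r" by auto
    then have "(v = [] \<or> v \<in> nonroot (Nd l r)) \<and> (2 \<le> i \<longrightarrow> v @ [i - 1] \<in> nonroot (Nd l r))"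
    proof cases
      case 1
      then show ?thesis by simp
    next
      case 2
      then obtain u where "w = u @ [i]" "v = 1 # u"
        by (cases v) (auto simp: append_eq_Cons_conv)
      then show ?thesis using L[of u i] 2 by auto
    next
      case 3
      then obtain j u where w: "w = j # u" by (cases w) auto
      have j: "1 \<le> j" using nonroot_subset_verts[of r] 3 w by (auto simp: verts_def)
      show ?thesis
      proof (cases v)
        case Nil
        then have "i = Suc j" "u = []" using 3 w by auto
        then show ?thesis using R[of "[]" j] 3 w j Nil
          by (cases "j = 1") (auto simp: image_iff intro!: bexI[of _ "[j - 1]"])
      next
        case (Cons a v')
        then have "a = Suc j" "u = v' @ [i]" using 3 w by auto
        then show ?thesis using R[of "j # v'" i] 3 w Cons
          by (force simp: image_iff)
      qed
    qed
    then show "v = [] \<or> v \<in> nonroot (Nd l r)" "2 \<le> i \<Longrightarrow> v @ [i - 1] \<in> nonroot (Nd l r)" by auto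
  qed
qed

lemma ordered_trees_iff: "T \<in> ordered_trees \<longleftrightarrow> [] \<in> T \<and> below_root (T - {[]})"
proof
  assume T: "T \<in> ordered_trees"
  then have "T \<subseteq> verts" "[] \<in> T" by (auto simp: ordered_trees_def is_tree_def)
  moreover have "v \<in> T" if "v @ [i] \<in> T" for v i
    using ordered_tree_parent[OF T that] by simp
  moreover have "v @ [i - 1] \<in> T" if "v @ [i] \<in> T" "2 \<le> i" for v i
    using T that unfolding ordered_trees_def by (auto dest!: bspec[of T _ "v @ [i]"])
  ultimately show "[] \<in> T \<and> below_root (T - {[]})" by (auto simp: below_root_def)
next
  assume T: "[] \<in> T \<and> below_root (T - {[]})"
  have root: "(v, []) \<in> (parent_edges T \<union> (parent_edges T)\<inverse>)\<^sup>*
      \<and> ([], v) \<in> (parent_edges T \<union> (parent_edges T)\<inverse>)\<^sup>*" if "v \<in> T" for v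
    using that
  proof (induction v rule: rev_induct)
    case (snoc i v)
    then have v: "v \<in> T" using T by (auto simp: below_root_def)
    with snoc.prems have "(v @ [i], v) \<in> parent_edges T" by (force simp: parent_edges_def)
    with snoc.IH[OF v] show ?case
      by (auto intro: converse_rtrancl_into_rtrancl rtrancl.rtrancl_into_rtrancl)
  qed simp
  have "v \<noteq> [] \<and> 2 \<le> last v \<longrightarrow> butlast v @ [last v - 1] \<in> T" if "v \<in> T" for v
    using T that by (cases v rule: rev_cases) (auto simp: below_root_def)
  moreover have "is_tree T" unfolding is_tree_def
  proof (intro conjI ballI)
    show "T \<subseteq> verts" using T by (auto simp: below_root_def verts_def)
    show "(u, v) \<in> (parent_edges T \<union> (parent_edges T)\<inverse>)\<^sup>*" if "u \<in> T" "v \<in> T" for u v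
      using root[OF that(1)] root[OF that(2)] by (meson rtrancl_trans)
  qed
  ultimately show "T \<in> ordered_trees" using T by (auto simp: ordered_trees_def)
qed

lemma ordered_tree_of_bij: "bij_betw ordered_tree_of {t. nodes t = n} (ordered_trees_of_size (Suc n))"
  unfolding bij_betw_def
proof
  have nonroot: "nonroot t = ordered_tree_of t - {[]}" for t by (simp add: ordered_tree_of_def)
  show "inj_on ordered_tree_of {t. nodes t = n}"
    by (rule inj_onI) (metis nonroot injD inj_nonroot)
  show "ordered_tree_of ` {t. nodes t = n} = ordered_trees_of_size (Suc n)"
  proof
    show "ordered_tree_of ` {t. nodes t = n} \<subseteq> ordered_trees_of_size (Suc n)"
      using below_root_nonroot by (auto simp: ordered_tree_of_def ordered_trees_of_size_def ordered_trees_iff card_nonroot)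
    show "ordered_trees_of_size (Suc n) \<subseteq> ordered_tree_of ` {t. nodes t = n}"
    proof
      fix T assume "T \<in> ordered_trees_of_size (Suc n)"
      then have T: "[] \<in> T" "below_root (T - {[]})" "finite (T - {[]})" "card (T - {[]}) = n"
        by (auto simp: ordered_trees_of_size_def ordered_trees_iff)
      define t where "t = trunc (Suc n) (T - {[]})"
      have t: "nodes t = n" unfolding t_def using T by (subst nodes_trunc_eq_iff) auto
      then have "nonroot t = T - {[]}" unfolding t_def by (intro nonroot_trunc_eq T) simp
      then have "ordered_tree_of t = T" using T by (auto simp: ordered_tree_of_def)
      with t show "T \<in> ordered_tree_of ` {t. nodes t = n}" by blast
    qed
  qed
qed

text \<open>The laws for different heights are consistent, so a truncation that is tall enough to show the size
  of the tree also carries the law of a shorter one.\<close>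

lemma map_trunc_tree_pmf: "h \<le> H \<Longrightarrow> map_pmf (\<lambda>t. trunc h (nonroot t)) (tree_pmf W H N) = tree_pmf W h N"
proof (induction h arbitrary: H N)
  case (Suc h)
  then obtain H' where H: "H = Suc H'" "h \<le> H'" by (cases H) auto
  have "map_pmf (\<lambda>t. trunc (Suc h) (nonroot t)) (map_pmf (\<lambda>(l, r). Nd l r) (pair_pmf A B))
      = map_pmf (\<lambda>(l, r). Nd l r) (pair_pmf (map_pmf (\<lambda>t. trunc h (nonroot t)) A) (map_pmf (\<lambda>t. trunc h (nonroot t)) B))"
    for A B
    unfolding map_pair[symmetric] pmf.map_comp
    by (intro map_pmf_cong refl) (auto simp: left_part_nonroot right_part_nonroot simp del: nonroot.simps(2))
  then show ?case using H Suc.IH[OF H(2)]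
    by (auto simp: map_bind_pmf intro!: bind_pmf_cong)
qed (simp add: map_pmf_const)

lemma uniform_tree_eq:
  assumes "n \<le> h"
  shows "uniform_tree (Suc n) = distr (measure_pmf (tree_pmf (size_split p) h (enat n))) tree_space ordered_tree_of"
proof -
  define S where "S = {t. nodes t = n}"
  have "S \<subseteq> {t. height t \<le> n}" by (auto simp: S_def intro: height_le_nodes)
  then have fin: "finite S" by (rule finite_subset[OF _ finite_height_le])
  have "(\<Sum>t\<in>S. pmf (tree_pmf (size_split p) h (enat n)) t) = 1"
    using assms by (intro sum_pmf_eq_1 fin) (auto simp: S_def set_pmf_iff pmf_tree_pmf_enat split: if_splits)
  then have card: "real (card S) = catalan n"
    using assms by (simp add: S_def pmf_tree_pmf_enat field_simps)
  then have ne: "S \<noteq> {}" by (metis card.empty catalan_nonzero of_nat_0)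
  have "tree_pmf (size_split p) h (enat n) = pmf_of_set S"
    using assms by (intro pmf_eqI)
      (simp add: pmf_of_set[OF ne fin] pmf_tree_pmf_enat card indicator_def, simp add: S_def)
  then have "map_pmf ordered_tree_of (tree_pmf (size_split p) h (enat n)) = pmf_of_set (ordered_trees_of_size (Suc n))"
    using ordered_tree_of_bij[of n] ne fin by (simp add: map_pmf_of_set_inj bij_betw_def S_def[symmetric])
  then have law: "measure_pmf (pmf_of_set (ordered_trees_of_size (Suc n)))
      = distr (measure_pmf (tree_pmf (size_split p) h (enat n))) (count_space UNIV) ordered_tree_of"
    by (simp add: map_pmf_rep_eq[symmetric])
  have sub: "ordered_trees_of_size (Suc n) \<subseteq> Pow verts"
    by (auto simp: ordered_trees_of_size_def ordered_trees_def is_tree_def)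
  have tree_verts: "ordered_tree_of t \<subseteq> verts" for t using nonroot_subset_verts[of t] by (auto simp: ordered_tree_of_def verts_def)
  show ?thesis
  proof (rule measure_eqI)
    fix X assume "X \<in> sets (uniform_tree (Suc n))"
    then have X: "X \<in> sets tree_space" by (simp add: uniform_tree_def)
    let ?O = "ordered_trees_of_size (Suc n)"
    have "emeasure (uniform_tree (Suc n)) X = emeasure (uniform_count_measure ?O) (?O \<inter> X)"
      unfolding uniform_tree_def using X
      by (subst emeasure_distr[OF uniform_tree_measurable])
        (auto simp: space_uniform_count_measure intro!: arg_cong[where f = "emeasure _"])
    also have "\<dots> = emeasure (measure_pmf (pmf_of_set ?O)) X"
      using finite_ordered_trees_of_size[of "Suc n"] ordered_trees_of_size_nonempty[of "Suc n"]
      by (subst emeasure_uniform_count_measure) (auto simp: emeasure_pmf_of_set Int_commute ennreal_of_nat_eq_real_of_nat)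
    also have "\<dots> = emeasure (distr (measure_pmf (tree_pmf (size_split p) h (enat n))) tree_space ordered_tree_of) X"
      unfolding law using X by (simp add: emeasure_distr tree_verts)
    finally show "emeasure (uniform_tree (Suc n)) X
      = emeasure (distr (measure_pmf (tree_pmf (size_split p) h (enat n))) tree_space ordered_tree_of) X" .
  qed (simp add: uniform_tree_def)
qed

section \<open>The geometric Galton--Watson tree as a percolation cluster\<close>

text \<open>Induction downwards from the maximal elements of \<open>S\<close>.\<close>

lemma eq_if_up_sums_eq:
  fixes f g :: "'a::order \<Rightarrow> real"
  assumes S: "finite S"
    and eq: "\<And>t. t \<in> S \<Longrightarrow> (\<Sum>s\<in>{s \<in> S. t \<le> s}. f s) = (\<Sum>s\<in>{s \<in> S. t \<le> s}. g s)"
    and "t \<in> S"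
  shows "f t = g t"
  using \<open>t \<in> S\<close>
proof (induction "card {s \<in> S. t < s}" arbitrary: t rule: less_induct)
  case less
  have "f s = g s" if "s \<in> S" "t < s" for s
  proof (rule less.hyps)
    show "card {u \<in> S. s < u} < card {u \<in> S. t < u}"
      using that S by (intro psubset_card_mono) auto
  qed (rule that)
  then have "(\<Sum>s\<in>{s \<in> S. t < s}. f s) = (\<Sum>s\<in>{s \<in> S. t < s}. g s)" by (intro sum.cong) auto
  moreover have "{s \<in> S. t \<le> s} = insert t {s \<in> S. t < s}" using less.prems by auto
  ultimately show ?case using eq[OF less.prems] S by simp
qed

lemma trunc_eq_iff:
  "trunc h V = t \<longleftrightarrow> height t \<le> h \<and> (\<forall>s. height s \<le> h \<longrightarrow> (nonroot s \<subseteq> V \<longleftrightarrow> s \<le> t))"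
proof
  assume "trunc h V = t"
  then show "height t \<le> h \<and> (\<forall>s. height s \<le> h \<longrightarrow> (nonroot s \<subseteq> V \<longleftrightarrow> s \<le> t))"
    using height_trunc nonroot_subset_iff by blast
next
  assume *: "height t \<le> h \<and> (\<forall>s. height s \<le> h \<longrightarrow> (nonroot s \<subseteq> V \<longleftrightarrow> s \<le> t))"
  then have "t \<le> trunc h V" using nonroot_subset_iff by blast
  moreover have "trunc h V \<le> t" using * height_trunc nonroot_trunc_subset by blast
  ultimately show "trunc h V = t" by simp
qed

lemma nonroot_subset_minus_root: "nonroot t \<subseteq> T - {[]} \<longleftrightarrow> nonroot t \<subseteq> T"
  by auto

text \<open>The value of the truncation is determined by which of the countably many finite trees are contained
  in the vertex set.\<close>

lemma trunc_measurable:
  "(\<lambda>T. trunc h (T - {[]})) \<in> measurable tree_space (count_space UNIV)"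
  unfolding measurable_count_space_eq2_countable
proof (intro conjI ballI)
  fix t
  have [measurable]: "Measurable.pred tree_space (\<lambda>T. \<forall>v\<in>nonroot s. v \<in> T)" for s
    using nonroot_subset_verts[of s] by (intro pred_intros_finite pred_mem_tree_space) auto
  have "Measurable.pred tree_space (\<lambda>T. height t \<le> h \<and> (\<forall>s. height s \<le> h \<longrightarrow> ((\<forall>v\<in>nonroot s. v \<in> T) \<longleftrightarrow> s \<le> t)))"
    by measurable
  moreover have "trunc h (T - {[]}) = t \<longleftrightarrow>
      height t \<le> h \<and> (\<forall>s. height s \<le> h \<longrightarrow> ((\<forall>v\<in>nonroot s. v \<in> T) \<longleftrightarrow> s \<le> t))" for T
    unfolding trunc_eq_iff nonroot_subset_minus_root by (simp only: subset_eq)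
  then have "(\<lambda>T. trunc h (T - {[]})) -` {t} \<inter> space tree_space
      = {T \<in> space tree_space. height t \<le> h \<and> (\<forall>s. height s \<le> h \<longrightarrow> ((\<forall>v\<in>nonroot s. v \<in> T) \<longleftrightarrow> s \<le> t))}"
    by (simp add: vimage_def Int_def conj_commute)
  ultimately show "(\<lambda>T. trunc h (T - {[]})) -` {t} \<inter> space tree_space \<in> sets tree_space"
    by (simp add: pred_def)
qed simp

lemma ordered_tree_of_subset_verts: "ordered_tree_of t \<subseteq> verts"
  using nonroot_subset_verts[of t] by (auto simp: ordered_tree_of_def verts_def)

lemma ordered_tree_of_ordered: "ordered_tree_of t \<in> ordered_trees"
  by (simp add: ordered_trees_iff ordered_tree_of_def below_root_nonroot)

lemma finite_ordered_tree_of [simp]: "finite (ordered_tree_of t)"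
  by (simp add: ordered_tree_of_def)

lemma card_ordered_tree_of: "card (ordered_tree_of t) = Suc (nodes t)"
  by (simp add: ordered_tree_of_def card_nonroot)

lemma gw_tree_ordered: "gw_tree X \<in> ordered_trees"
  unfolding ordered_trees_iff below_root_def
proof (intro conjI allI impI)
  show "[] \<in> gw_tree X" by (simp add: mem_gw_tree_iff verts_def)
  show "gw_tree X - {[]} \<subseteq> verts - {[]}" by (auto simp: mem_gw_tree_iff)
  fix v i assume "v @ [i] \<in> gw_tree X - {[]}"
  then have vi: "v @ [i] \<in> verts"
    "\<And>j. j < Suc (length v) \<Longrightarrow> enat ((v @ [i]) ! j) \<le> X (take j (v @ [i]))"
    by (auto simp: mem_gw_tree_iff)
  have v: "enat (v ! j) \<le> X (take j v)" if "j < length v" for j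
    using vi(2)[of j] that by (simp add: nth_append)
  have i: "enat i \<le> X v" using vi(2)[of "length v"] by simp
  show "v = [] \<or> v \<in> gw_tree X - {[]}" using vi(1) v by (auto simp: mem_gw_tree_iff verts_def)
  assume "2 \<le> i"
  have "enat (i - 1) \<le> X v" by (rule order_trans[OF _ i]) simp
  then have "enat ((v @ [i - 1]) ! j) \<le> X (take j (v @ [i - 1]))" if "j < Suc (length v)" for j
    using v[of j] that by (cases "j = length v") (simp_all add: nth_append)
  moreover have "v @ [i - 1] \<in> verts" using vi(1) \<open>2 \<le> i\<close> by (auto simp: verts_def)
  ultimately show "v @ [i - 1] \<in> gw_tree X - {[]}" by (simp add: mem_gw_tree_iff)
qed

lemma initial_segment_eq_card:
  fixes C :: "nat set"
  assumes "finite C" "\<And>i. i \<in> C \<Longrightarrow> 1 \<le> i" "\<And>i j. i \<in> C \<Longrightarrow> 1 \<le> j \<Longrightarrow> j \<le> i \<Longrightarrow> j \<in> C"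
  shows "C = {1..card C}"
proof (cases "C = {}")
  case False
  have eq: "C = {1..Max C}"
  proof
    show "C \<subseteq> {1..Max C}" using assms(1,2) by auto
    show "{1..Max C} \<subseteq> C" using assms(3)[OF Max_in[OF assms(1) False]] by auto
  qed
  have "card C = Max C" using arg_cong[OF eq, of card] by simp
  then show ?thesis by (subst \<open>card C = Max C\<close>) (rule eq)
qed simp

definition child_count :: "vertex set \<Rightarrow> vertex \<Rightarrow> nat" where
  "child_count T v = card {i. v @ [i] \<in> T}"

lemma ordered_tree_children:
  assumes T: "T \<in> ordered_trees" "finite T"
  shows "{i. v @ [i] \<in> T} = {1..child_count T v}"
  unfolding child_count_def
proof (rule initial_segment_eq_card)
  have "(\<lambda>i. v @ [i]) ` {i. v @ [i] \<in> T} \<subseteq> T" by auto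
  from finite_subset[OF this T(2)] show "finite {i. v @ [i] \<in> T}"
    by (rule finite_imageD) (auto simp: inj_on_def)
  show "1 \<le> i" if "i \<in> {i. v @ [i] \<in> T}" for i
    using T that by (auto simp: ordered_trees_def is_tree_def verts_def)
  show "j \<in> {i. v @ [i] \<in> T}" if "i \<in> {i. v @ [i] \<in> T}" "1 \<le> j" "j \<le> i" for i j
    using ordered_tree_sibling[OF T(1), of v j "i - j"] that by simp
qed

text \<open>Every vertex other than the root is a child of exactly one vertex.\<close>

lemma sum_child_count:
  assumes T: "T \<in> ordered_trees" "finite T"
  shows "(\<Sum>v\<in>T. child_count T v) = card T - 1"
proof -
  have "(\<Sum>v\<in>T. child_count T v) = card (SIGMA v:T. {i. v @ [i] \<in> T})"
    unfolding child_count_def using T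
    by (intro card_SigmaI[symmetric]) (auto simp: ordered_tree_children)
  also have "\<dots> = card ((\<lambda>(v, i). v @ [i]) ` (SIGMA v:T. {i. v @ [i] \<in> T}))"
    by (rule card_image[symmetric]) (auto simp: inj_on_def)
  also have "(\<lambda>(v, i). v @ [i]) ` (SIGMA v:T. {i. v @ [i] \<in> T}) = T - {[]}"
  proof
    show "T - {[]} \<subseteq> (\<lambda>(v, i). v @ [i]) ` (SIGMA v:T. {i. v @ [i] \<in> T})"
    proof
      fix u assume "u \<in> T - {[]}"
      then show "u \<in> (\<lambda>(v, i). v @ [i]) ` (SIGMA v:T. {i. v @ [i] \<in> T})"
        using ordered_tree_parent[OF T(1), of u] by (cases u rule: rev_cases) auto
    qed
  qed auto
  also have "card (T - {[]}) = card T - 1" using T by (simp add: ordered_trees_def)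
  finally show ?thesis .
qed

lemma subset_gw_tree_iff:
  assumes T: "T \<in> ordered_trees" "finite T"
  shows "T \<subseteq> gw_tree X \<longleftrightarrow> (\<forall>v\<in>T. enat (child_count T v) \<le> X v)"
proof
  assume sub: "T \<subseteq> gw_tree X"
  show "\<forall>v\<in>T. enat (child_count T v) \<le> X v"
  proof
    fix v assume "v \<in> T"
    show "enat (child_count T v) \<le> X v"
    proof (cases "child_count T v = 0")
      case False
      then have "v @ [child_count T v] \<in> T" using ordered_tree_children[OF T, of v] by auto
      with sub have "v @ [child_count T v] \<in> gw_tree X" by blast
      then show ?thesis by (auto simp: mem_gw_tree_iff dest!: spec[of _ "length v"])
    qed (simp flip: zero_enat_def)
  qed
next
  assume X: "\<forall>v\<in>T. enat (child_count T v) \<le> X v"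
  show "T \<subseteq> gw_tree X"
  proof
    fix v assume v: "v \<in> T"
    have "enat (v ! i) \<le> X (take i v)" if "i < length v" for i
    proof -
      have "take i v @ [v ! i] \<in> T"
        using ordered_tree_take[OF T(1) v, of "Suc i"] that by (simp add: take_Suc_conv_app_nth)
      then have "v ! i \<le> child_count T (take i v)" using ordered_tree_children[OF T, of "take i v"] by auto
      moreover have "enat (child_count T (take i v)) \<le> X (take i v)"
        using X ordered_tree_take[OF T(1) v] by blast
      ultimately show ?thesis by (meson enat_ord_simps(1) order_trans)
    qed
    moreover have "v \<in> verts" using T v by (auto simp: ordered_trees_def is_tree_def)
    ultimately show "v \<in> gw_tree X" by (simp add: mem_gw_tree_iff)
  qed
qed

lemma offspring_tail:
  assumes "0 < p" "p \<le> 1"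
  shows "emeasure (offspring p) {X. enat k \<le> X} = ennreal (p ^ k)"
proof (cases "p = 1")
  case True
  then show ?thesis by (simp add: offspring_def indicator_def)
next
  case False
  with assms have p: "0 < p" "p < 1" by auto
  have "{j. k \<le> j} = space (geometric_pmf (1 - p)) - {..<k}" by auto
  then have "measure (geometric_pmf (1 - p)) {j. k \<le> j} = 1 - measure (geometric_pmf (1 - p)) {..<k}"
    by (simp add: measure_pmf.prob_compl del: space_measure_pmf)
  also have "\<dots> = p ^ k"
    using p one_diff_power_eq[of p k]
    by (simp add: measure_measure_pmf_finite mult.commute[of "1 - p"] flip: sum_distrib_right)
  finally show ?thesis using p
    by (simp add: offspring_def measure_pmf.emeasure_eq_measure vimage_def)
qed

abbreviation gw_space :: "real \<Rightarrow> (vertex \<Rightarrow> enat) measure" where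
  "gw_space p \<equiv> Pi\<^sub>M verts (\<lambda>_. measure_pmf (offspring p))"

lemma prob_space_gw_space: "prob_space (gw_space p)"
  by (intro prob_space_PiM prob_space_measure_pmf)

text \<open>Each vertex of \<open>T\<close> must have at least as many children as in \<open>T\<close>, and these requirements are
  independent with geometric tails \<open>p ^ k\<close>.\<close>

lemma gw_tree_contains:
  assumes p: "0 < p" "p \<le> 1" and T: "T \<in> ordered_trees" "finite T"
  shows "measure (gw_space p) {X \<in> space (gw_space p). T \<subseteq> gw_tree X} = p ^ (card T - 1)"
proof -
  interpret product_prob_space "\<lambda>_. measure_pmf (offspring p)" verts ..
  have "emeasure (gw_space p) {X \<in> space (gw_space p). T \<subseteq> gw_tree X}
      = emeasure (gw_space p) {X \<in> space (gw_space p). \<forall>v\<in>T. X v \<in> {x. enat (child_count T v) \<le> x}}"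
    by (simp add: subset_gw_tree_iff[OF T])
  also have "\<dots> = (\<Prod>v\<in>T. emeasure (offspring p) {x. enat (child_count T v) \<le> x})"
    using T by (intro emeasure_PiM_Collect) (auto simp: ordered_trees_def is_tree_def)
  also have "\<dots> = (\<Prod>v\<in>T. ennreal (p ^ child_count T v))" using p by (simp add: offspring_tail)
  also have "\<dots> = ennreal (\<Prod>v\<in>T. p ^ child_count T v)" using p by (intro prod_ennreal) auto
  also have "(\<Prod>v\<in>T. p ^ child_count T v) = p ^ (card T - 1)"
    by (simp add: sum_child_count[OF T] flip: power_sum)
  finally show ?thesis using p by (simp add: P.emeasure_eq_measure)
qed

definition gw_trunc :: "nat \<Rightarrow> (vertex \<Rightarrow> enat) \<Rightarrow> bintree" where
  "gw_trunc h X = trunc h (gw_tree X - {[]})"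

lemma gw_trunc_measurable [measurable]: "gw_trunc h \<in> measurable (gw_space p) (count_space UNIV)"
  unfolding gw_trunc_def by (rule measurable_compose[OF gw_tree_measurable trunc_measurable])

lemma gw_infinite_measurable [measurable]: "Measurable.pred (gw_space p) (\<lambda>X. infinite (gw_tree X))"
proof -
  have "gw_tree -` {T \<in> space tree_space. infinite T} \<inter> space (gw_space p) \<in> sets (gw_space p)"
    by (rule measurable_sets[OF gw_tree_measurable infinite_trees_measurable])
  moreover have "gw_tree -` {T \<in> space tree_space. infinite T} \<inter> space (gw_space p)
      = {X \<in> space (gw_space p). infinite (gw_tree X)}"
    by (auto simp: mem_gw_tree_iff)
  ultimately show ?thesis by (simp add: pred_def)
qed

context
  fixes p :: real
  assumes p: "1/2 < p" "p \<le> 1"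
begin

text \<open>Both laws give probability \<open>p ^ nodes t\<close> to the trees containing \<open>t\<close>, and on the finite set of
  trees of height at most \<open>h\<close> these probabilities determine the law.\<close>

lemma distr_gw_trunc: "distr (gw_space p) (count_space UNIV) (gw_trunc h) = measure_pmf (cluster_pmf p h)"
proof (rule measure_eqI_countable[where A = UNIV])
  interpret N: prob_space "gw_space p" by (rule prob_space_gw_space)
  interpret D: prob_space "distr (gw_space p) (count_space UNIV) (gw_trunc h)"
    by (rule N.prob_space_distr) (rule gw_trunc_measurable)
  let ?D = "distr (gw_space p) (count_space UNIV) (gw_trunc h)"
  define S where "S = {t. height t \<le> h}"
  have S: "finite S" unfolding S_def by (rule finite_height_le)
  have D: "measure ?D A = measure (gw_space p) {X \<in> space (gw_space p). gw_trunc h X \<in> A}" for A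
    by (subst measure_distr) (auto intro!: arg_cong[where f = "measure _"])
  have height: "height t \<le> h" if "t \<in> set_pmf (cluster_pmf p h)" for t
    using that set_tree_pmf_nodes[OF set_size_split[OF p]] by (auto simp: cluster_pmf_def[OF p])
  have "measure ?D {t} = pmf (cluster_pmf p h) t" for t
  proof (cases "t \<in> S")
    case True
    show ?thesis
    proof (rule eq_if_up_sums_eq[OF S _ True])
      fix t assume t: "t \<in> S"
      have "(\<Sum>s\<in>{s \<in> S. t \<le> s}. measure ?D {s}) = measure ?D {s \<in> S. t \<le> s}"
        using S by (intro D.finite_measure_eq_sum_singleton[symmetric]) auto
      also have "\<dots> = measure (gw_space p) {X \<in> space (gw_space p). ordered_tree_of t \<subseteq> gw_tree X}"
        unfolding D using t gw_tree_ordered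
        by (intro arg_cong[where f = "measure _"] Collect_cong)
          (auto simp: S_def gw_trunc_def height_trunc nonroot_subset_iff[symmetric] ordered_tree_of_def ordered_trees_def)
      also have "\<dots> = p ^ nodes t"
        using p gw_tree_contains[OF _ _ ordered_tree_of_ordered, of p t] by (simp add: card_ordered_tree_of)
      also have "\<dots> = measure (cluster_pmf p h) {s. t \<le> s}"
        using t by (simp add: cluster_pmf_cone[OF p] S_def)
      also have "\<dots> = measure (cluster_pmf p h) {s \<in> S. t \<le> s}"
        by (rule measure_prob_cong_0) (auto simp: S_def pmf_eq_0_set_pmf dest: height)
      also have "\<dots> = (\<Sum>s\<in>{s \<in> S. t \<le> s}. pmf (cluster_pmf p h) s)"
        using S by (intro measure_measure_pmf_finite) auto
      finally show "(\<Sum>s\<in>{s \<in> S. t \<le> s}. measure ?D {s}) = (\<Sum>s\<in>{s \<in> S. t \<le> s}. pmf (cluster_pmf p h) s)" .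
    qed
  next
    case False
    then have "pmf (cluster_pmf p h) t = 0" by (auto simp: S_def pmf_eq_0_set_pmf dest: height)
    moreover have "{X \<in> space (gw_space p). gw_trunc h X \<in> {t}} = {}"
      using False height_trunc by (auto simp: S_def gw_trunc_def)
    ultimately show ?thesis unfolding D by (metis measure_empty)
  qed
  then show "emeasure ?D {t} = emeasure (measure_pmf (cluster_pmf p h)) {t}" for t
    by (simp add: D.emeasure_eq_measure emeasure_pmf_single)
qed auto

lemma measure_gw_trunc:
  "measure (gw_space p) {X \<in> space (gw_space p). gw_trunc h X \<in> A} = measure (cluster_pmf p h) A"
proof -
  have "measure (gw_space p) {X \<in> space (gw_space p). gw_trunc h X \<in> A}
      = measure (distr (gw_space p) (count_space UNIV) (gw_trunc h)) A"
    by (subst measure_distr) (auto intro!: arg_cong[where f = "measure _"])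
  then show ?thesis by (simp add: distr_gw_trunc)
qed

lemma gw_trunc_size_eq:
  assumes "h \<le> H" "m < H"
  shows "{X \<in> space (gw_space p). gw_trunc h X = t \<and>
      finite (gw_tree X - {[]}) \<and> card (gw_tree X - {[]}) = m}
    = {X \<in> space (gw_space p). gw_trunc H X \<in> {s. nodes s = m \<and> trunc h (nonroot s) = t}}"
  using gw_tree_ordered assms
  by (intro Collect_cong) (auto simp: gw_trunc_def trunc_nonroot_trunc nodes_trunc_eq_iff ordered_trees_iff)

lemma gw_trunc_finite:
  "measure (gw_space p) {X \<in> space (gw_space p). gw_trunc h X = t \<and>
      finite (gw_tree X - {[]}) \<and> card (gw_tree X - {[]}) = m}
    = pmf (progeny p) (enat m) * pmf (tree_pmf (size_split p) h (enat m)) t"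
proof -
  \<comment> \<open>A tree with \<open>m\<close> nodes has height below \<open>H\<close>, so the truncation at \<open>H\<close> determines whether the
    tree has \<open>m\<close> nodes.\<close>
  define H where "H = max h (Suc m)"
  define A where "A = {s. nodes s = m \<and> trunc h (nonroot s) = t}"
  have H: "h \<le> H" "m < H" by (auto simp: H_def)
  have nodes: "enat (nodes t) \<le> N \<and> min N (enat H) \<le> enat (nodes t)"
    if "t \<in> set_pmf (tree_pmf (size_split p) H N)" for t N
    using set_tree_pmf_nodes[OF set_size_split[OF p] that] by simp
  have "measure (gw_space p) {X \<in> space (gw_space p). gw_trunc h X = t \<and>
      finite (gw_tree X - {[]}) \<and> card (gw_tree X - {[]}) = m}
    = measure (bind_pmf (progeny p) (tree_pmf (size_split p) H)) A"
    by (simp only: gw_trunc_size_eq[OF H] measure_gw_trunc cluster_pmf_def[OF p] A_def)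
  also have "\<dots> = (\<Sum>N\<in>{enat m}. measure (tree_pmf (size_split p) H N) A * pmf (progeny p) N)"
    unfolding measure_bind_pmf
  proof (rule integral_measure_pmf_real)
    fix N assume "measure (tree_pmf (size_split p) H N) A \<noteq> 0"
    then have "set_pmf (tree_pmf (size_split p) H N) \<inter> A \<noteq> {}"
      using measure_Int_set_pmf[of "tree_pmf (size_split p) H N" A] by (auto simp: Int_commute)
    then obtain s where "s \<in> set_pmf (tree_pmf (size_split p) H N)" "nodes s = m" by (auto simp: A_def)
    then show "N \<in> {enat m}" using nodes H by (cases N) (force simp: min_def split: if_splits)+
  qed simp
  also have "\<dots> = pmf (progeny p) (enat m) * measure (tree_pmf (size_split p) H (enat m)) A" by simp
  also have "measure (tree_pmf (size_split p) H (enat m)) A = measure (tree_pmf (size_split p) H (enat m)) {s. trunc h (nonroot s) = t}"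
  proof (rule measure_prob_cong_0)
    fix s assume "s \<in> {s. trunc h (nonroot s) = t} - A"
    then have "nodes s \<noteq> m" by (auto simp: A_def)
    then show "pmf (tree_pmf (size_split p) H (enat m)) s = 0"
      using H by (simp add: pmf_tree_pmf_enat)
  qed (auto simp: A_def)
  also have "measure (tree_pmf (size_split p) H (enat m)) {s. trunc h (nonroot s) = t}
      = pmf (map_pmf (\<lambda>s. trunc h (nonroot s)) (tree_pmf (size_split p) H (enat m))) t"
    by (simp add: pmf_map vimage_def)
  finally show ?thesis by (simp add: map_trunc_tree_pmf H(1))
qed

text \<open>The joint law of the truncation and the size is known for finite sizes by \<open>gw_trunc_finite\<close>, and
  the law of the truncation alone is that of a cluster. The infinite size accounts for the difference.\<close>

lemma gw_trunc_infinite: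
  "measure (gw_space p) {X \<in> space (gw_space p). gw_trunc h X = t \<and> infinite (gw_tree X)}
    = (2 * p - 1) / p * pmf (tree_pmf (size_split p) h \<infinity>) t"
proof -
  interpret N: prob_space "gw_space p" by (rule prob_space_gw_space)
  define g where "g N = pmf (progeny p) N * pmf (tree_pmf (size_split p) h N) t" for N
  \<comment> \<open>The joint law of the truncation and the size of a cluster.\<close>
  define J where "J = bind_pmf (progeny p) (\<lambda>N. map_pmf (\<lambda>t. (t, N)) (tree_pmf (size_split p) h N))"
  have J: "pmf J (t, N) = g N" for N
  proof -
    have inj: "pmf (map_pmf (\<lambda>t. (t, N)) q) (t, N) = pmf q t" for q :: "bintree pmf" and N :: enat
      by (rule pmf_map_inj') (auto simp: inj_on_def)
    have "pmf J (t, N) = (\<Sum>N\<in>{N}. pmf (map_pmf (\<lambda>t. (t, N)) (tree_pmf (size_split p) h N)) (t, N) * pmf (progeny p) N)"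
      unfolding J_def pmf_bind
    proof (subst integral_measure_pmf_real[where A = "{N}"])
      fix N' assume "pmf (map_pmf (\<lambda>t. (t, N')) (tree_pmf (size_split p) h N')) (t, N) \<noteq> 0"
      then have "(t, N) \<in> set_pmf (map_pmf (\<lambda>t. (t, N')) (tree_pmf (size_split p) h N'))"
        by (simp add: set_pmf_iff del: set_map_pmf pmf.set_map)
      then show "N' \<in> {N}" by auto
    qed simp_all
    then show ?thesis by (simp add: inj g_def)
  qed
  have fstJ: "map_pmf fst J = cluster_pmf p h"
    by (simp add: J_def cluster_pmf_def[OF p] map_bind_pmf pmf.map_comp o_def)
  have disj: "disjoint_family (\<lambda>m. {(t, enat m)})" by (auto simp: disjoint_family_on_def)
  have "(\<lambda>m. measure J {(t, enat m)}) sums measure J (\<Union>m. {(t, enat m)})"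
    by (rule measure_pmf.finite_measure_UNION[OF _ disj]) auto
  then have J_sums: "(\<lambda>m. g (enat m)) sums measure J (\<Union>m. {(t, enat m)})"
    by (simp add: measure_pmf_single J)
  have "pmf (cluster_pmf p h) t = measure J (fst -` {t})"
    unfolding fstJ[symmetric] by (simp add: pmf_map)
  also have "fst -` {t} = (\<Union>m. {(t, enat m)}) \<union> {(t, \<infinity>)}"
    by auto
  also have "measure J \<dots> = measure J (\<Union>m. {(t, enat m)}) + g \<infinity>"
    by (subst measure_pmf.finite_measure_Union) (auto simp: measure_pmf_single J)
  finally have J_total: "pmf (cluster_pmf p h) t = measure J (\<Union>m. {(t, enat m)}) + g \<infinity>" .
  define E where "E m = {X \<in> space (gw_space p). gw_trunc h X = t \<and>
      finite (gw_tree X - {[]}) \<and> card (gw_tree X - {[]}) = m}" for m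
  have E_sets: "E m \<in> sets (gw_space p)" for m
  proof -
    have "E m = {X \<in> space (gw_space p).
        gw_trunc (max h (Suc m)) X \<in> {s. nodes s = m \<and> trunc h (nonroot s) = t}}"
      unfolding E_def by (rule gw_trunc_size_eq) auto
    also have "\<dots> \<in> sets (gw_space p)" by measurable
    finally show ?thesis .
  qed
  define I where "I = {X \<in> space (gw_space p). gw_trunc h X = t \<and> infinite (gw_tree X)}"
  have I_sets: "I \<in> sets (gw_space p)" unfolding I_def by measurable
  have "(\<lambda>m. measure (gw_space p) (E m)) sums measure (gw_space p) (\<Union>m. E m)"
    using E_sets by (intro N.finite_measure_UNION) (auto simp: disjoint_family_on_def E_def)
  then have "(\<lambda>m. g (enat m)) sums measure (gw_space p) (\<Union>m. E m)"
    by (simp only: E_def gw_trunc_finite g_def)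
  then have fin: "measure (gw_space p) (\<Union>m. E m) = measure J (\<Union>m. {(t, enat m)})"
    using J_sums sums_unique2 by blast
  have "pmf (cluster_pmf p h) t = measure (gw_space p) {X \<in> space (gw_space p). gw_trunc h X \<in> {t}}"
    by (simp only: measure_gw_trunc measure_pmf_single)
  also have "{X \<in> space (gw_space p). gw_trunc h X \<in> {t}} = (\<Union>m. E m) \<union> I"
    by (auto simp: E_def I_def)
  also have "measure (gw_space p) \<dots> = measure (gw_space p) (\<Union>m. E m) + measure (gw_space p) I"
    using E_sets I_sets by (intro N.finite_measure_Union) (auto simp: E_def I_def)
  finally have "measure (gw_space p) I = g \<infinity>" using J_total fin by simp
  then show ?thesis by (simp add: I_def g_def pmf_progeny[OF p])
qed

end

section \<open>Couplings of ordered trees\<close>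

lemma pred_subset_tree_space:
  assumes "A \<in> measurable M tree_space" "B \<in> measurable M tree_space"
  shows "Measurable.pred M (\<lambda>\<omega>. A \<omega> \<subseteq> B \<omega>)"
proof -
  have mem: "Measurable.pred M (\<lambda>\<omega>. v \<in> C \<omega>)" if "v \<in> verts" "C \<in> measurable M tree_space" for v C
    using measurable_compose[OF that(2) pred_mem_tree_space[OF that(1)]] .
  have "Measurable.pred M (\<lambda>\<omega>. \<forall>v\<in>verts. v \<in> A \<omega> \<longrightarrow> v \<in> B \<omega>)"
    using assms by (intro pred_intros_countable_bounded countable_verts pred_intros_logic mem)
  moreover have "A \<omega> \<subseteq> verts" if "\<omega> \<in> space M" for \<omega>
    using measurable_space[OF assms(1) that] by simp
  ultimately show ?thesis
    by (subst measurable_cong[where g = "\<lambda>\<omega>. \<forall>v\<in>verts. v \<in> A \<omega> \<longrightarrow> v \<in> B \<omega>"]) (blast, assumption)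
qed

text \<open>The joint law of the two trees serves as the probability space.\<close>

lemma coupling_on_pairs:
  fixes M :: "'w measure"
  assumes M: "prob_space M"
    and A: "random_tree_with_law M A \<mu>" and B: "random_tree_with_law M B \<nu>"
    and sub: "AE \<omega> in M. A \<omega> \<subseteq> B \<omega>"
  shows "\<exists>(\<Omega> :: (vertex set \<times> vertex set) measure) S T.
           prob_space \<Omega> \<and> random_tree_with_law \<Omega> S \<mu> \<and> random_tree_with_law \<Omega> T \<nu> \<and>
           \<P>(\<omega> in \<Omega>. S \<omega> \<subseteq> T \<omega>) = 1"
proof -
  interpret M: prob_space M by (rule M)
  have meas [measurable]: "A \<in> measurable M tree_space" "B \<in> measurable M tree_space"
    using A B by (auto simp: random_tree_with_law_def)
  define \<Omega> where "\<Omega> = distr M (tree_space \<Otimes>\<^sub>M tree_space) (\<lambda>\<omega>. (A \<omega>, B \<omega>))"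
  have pair: "(\<lambda>\<omega>. (A \<omega>, B \<omega>)) \<in> measurable M (tree_space \<Otimes>\<^sub>M tree_space)" by measurable
  interpret \<Omega>: prob_space \<Omega> unfolding \<Omega>_def by (rule M.prob_space_distr[OF pair])
  have proj: "fst \<in> measurable \<Omega> tree_space" "snd \<in> measurable \<Omega> tree_space"
    by (simp_all add: \<Omega>_def)
  have "distr \<Omega> tree_space fst = \<mu>" "distr \<Omega> tree_space snd = \<nu>"
    using A B unfolding \<Omega>_def by (subst distr_distr; simp add: pair o_def random_tree_with_law_def)+
  moreover have "\<P>(\<omega> in \<Omega>. fst \<omega> \<subseteq> snd \<omega>) = 1"
  proof (rule \<Omega>.prob_Collect_eq_1[THEN iffD2])
    have "Measurable.pred (tree_space \<Otimes>\<^sub>M tree_space) (\<lambda>\<omega> :: vertex set \<times> vertex set. fst \<omega> \<subseteq> snd \<omega>)"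
      by (rule pred_subset_tree_space) simp_all
    then have S: "{\<omega> \<in> space (tree_space \<Otimes>\<^sub>M tree_space). fst \<omega> \<subseteq> snd \<omega>} \<in> sets (tree_space \<Otimes>\<^sub>M tree_space)"
      by (simp add: pred_def)
    show "AE \<omega> in \<Omega>. fst \<omega> \<subseteq> snd \<omega>"
      unfolding \<Omega>_def using sub by (subst AE_distr_iff[OF pair S]) simp
    show "{\<omega> \<in> space \<Omega>. fst \<omega> \<subseteq> snd \<omega>} \<in> sets \<Omega>" using S by (simp add: \<Omega>_def)
  qed
  ultimately show ?thesis
    using proj \<Omega>.prob_space_axioms unfolding random_tree_with_law_def by blast
qed

lemma ordered_tree_of_measurable: "ordered_tree_of \<in> measurable (count_space UNIV) tree_space"
  by (simp add: ordered_tree_of_subset_verts)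

lemma random_tree_with_uniform_law:
  assumes Z: "Z \<in> measurable M (count_space UNIV)"
    and law: "distr M (count_space UNIV) Z = measure_pmf (tree_pmf (size_split p) h (enat n))" and "n \<le> h"
  shows "random_tree_with_law M (\<lambda>\<omega>. ordered_tree_of (Z \<omega>)) (uniform_tree (Suc n))"
  unfolding random_tree_with_law_def
proof
  show "(\<lambda>\<omega>. ordered_tree_of (Z \<omega>)) \<in> measurable M tree_space"
    by (rule measurable_compose[OF Z ordered_tree_of_measurable])
  have "distr M tree_space (\<lambda>\<omega>. ordered_tree_of (Z \<omega>)) = distr (distr M (count_space UNIV) Z) tree_space ordered_tree_of"
    by (subst distr_distr[OF ordered_tree_of_measurable Z]) (simp add: o_def)
  then show "distr M tree_space (\<lambda>\<omega>. ordered_tree_of (Z \<omega>)) = uniform_tree (Suc n)"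
    using uniform_tree_eq[OF \<open>n \<le> h\<close>, of p] by (simp add: law)
qed

lemma tree_pmf_enat_height_irrelevant:
  "n \<le> h \<Longrightarrow> n \<le> h' \<Longrightarrow> tree_pmf (size_split p) h (enat n) = tree_pmf (size_split p) h' (enat n)"
  by (rule pmf_eqI) (simp add: pmf_tree_pmf_enat)

text \<open>This is the theorem of Luczak and Winkler. The parameter 1 of \<open>size_split\<close> is an arbitrary choice
  from the range of \<open>size_split_mono\<close>: on finite sizes the split is the same for every parameter.\<close>

lemma increasing_coupling_exists:
  "\<exists>(\<Omega> :: (nat \<Rightarrow> vertex set) measure) T. increasing_coupling \<Omega> T"
proof -
  define \<mu> where "\<mu> n = tree_pmf (size_split 1) n (enat n)" for n
  have "rel_pmf (\<le>) (\<mu> n) (\<mu> (Suc n))" for n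
  proof -
    have eq: "\<mu> n = tree_pmf (size_split 1) (Suc n) (enat n)"
      unfolding \<mu>_def by (rule tree_pmf_enat_height_irrelevant) auto
    show ?thesis unfolding eq \<mu>_def[of "Suc n"] by (intro tree_pmf_mono size_split_mono) auto
  qed
  then obtain \<Omega> and X :: "nat \<Rightarrow> (nat \<times> bintree \<Rightarrow> bintree) \<Rightarrow> bintree" where \<Omega>: "prob_space \<Omega>"
    and X: "\<And>n. X n \<in> measurable \<Omega> (count_space UNIV)"
    and law: "\<And>n. distr \<Omega> (count_space UNIV) (X n) = measure_pmf (\<mu> n)"
    and incr: "AE \<omega> in \<Omega>. \<forall>n. X n \<omega> \<le> X (Suc n) \<omega>"
    by (rule rel_pmf_chain) blast
  interpret \<Omega>: prob_space \<Omega> by (rule \<Omega>)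
  have tree_X: "random_tree_with_law \<Omega> (\<lambda>\<omega>. ordered_tree_of (X n \<omega>)) (uniform_tree (Suc n))" for n
    by (rule random_tree_with_uniform_law[OF X law[unfolded \<mu>_def]]) simp
  define S where "S \<omega> n = ordered_tree_of (X n \<omega>)" for \<omega> n
  define P where "P = Pi\<^sub>M UNIV (\<lambda>_ :: nat. tree_space)"
  have S: "S \<in> measurable \<Omega> P"
    unfolding P_def S_def[abs_def]
    by (rule measurable_PiM_single') (use tree_X ordered_tree_of_subset_verts in \<open>auto simp: random_tree_with_law_def subset_iff\<close>)
  define Q where "Q = distr \<Omega> P S"
  interpret Q: prob_space Q unfolding Q_def by (rule \<Omega>.prob_space_distr[OF S])
  define T where "T k = (\<lambda>\<omega> :: nat \<Rightarrow> vertex set. \<omega> (k - 1))" for k :: nat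
  have coord: "(\<lambda>\<omega>. \<omega> n) \<in> measurable P tree_space" for n
    unfolding P_def by (rule measurable_component_singleton) simp
  have T_law: "random_tree_with_law Q (T k) (uniform_tree k)" if "1 \<le> k" for k
  proof -
    from that obtain n where k: "k = Suc n" by (cases k) auto
    have "distr Q tree_space (\<lambda>\<omega>. \<omega> n) = distr \<Omega> tree_space (\<lambda>\<omega>. ordered_tree_of (X n \<omega>))"
      unfolding Q_def by (subst distr_distr[OF coord S]) (simp add: o_def S_def)
    then show ?thesis using tree_X[of n] coord
      by (simp add: random_tree_with_law_def k T_def Q_def)
  qed
  have "Measurable.pred P (\<lambda>\<omega>. \<forall>k\<in>{1..}. T k \<omega> \<subseteq> T (Suc k) \<omega>)"
    unfolding T_def by (intro pred_intros_countable_bounded pred_subset_tree_space coord)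
  then have pred: "Measurable.pred P (\<lambda>\<omega>. \<forall>k\<ge>1. T k \<omega> \<subseteq> T (Suc k) \<omega>)"
    by (simp only: Ball_def atLeast_iff)
  have "\<P>(\<omega> in Q. \<forall>k\<ge>1. T k \<omega> \<subseteq> T (Suc k) \<omega>) = 1"
  proof (rule Q.prob_Collect_eq_1[THEN iffD2])
    show "{\<omega> \<in> space Q. \<forall>k\<ge>1. T k \<omega> \<subseteq> T (Suc k) \<omega>} \<in> sets Q"
      using pred by (simp only: Q_def pred_def space_distr sets_distr)
    have "AE \<omega> in \<Omega>. \<forall>k\<ge>1. T k (S \<omega>) \<subseteq> T (Suc k) (S \<omega>)"
      using incr
    proof (rule AE_mp, intro AE_I2 impI allI)
      fix \<omega> k assume "\<forall>n. X n \<omega> \<le> X (Suc n) \<omega>" and "1 \<le> (k :: nat)"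
      then have "nonroot (X (k - 1) \<omega>) \<subseteq> nonroot (X (Suc k - 1) \<omega>)"
        by (cases k) (simp_all add: nonroot_subset_nonroot_iff)
      then show "T k (S \<omega>) \<subseteq> T (Suc k) (S \<omega>)"
        unfolding T_def S_def ordered_tree_of_def by blast
    qed
    then show "AE \<omega> in Q. \<forall>k\<ge>1. T k \<omega> \<subseteq> T (Suc k) \<omega>"
      unfolding Q_def AE_distr_iff[OF S pred[unfolded pred_def]] .
  qed
  then have "increasing_coupling Q T"
    using T_law Q.prob_space_axioms by (simp add: increasing_coupling_def)
  then show ?thesis by blast
qed

text \<open>The infinite tree contains the members of the increasing coupling by construction, so an inclusion
  holds surely whichever increasing coupling defines it.\<close>

lemma coupling_at_half:
  assumes "1 \<le> k"
  shows "\<exists>(\<Omega> :: (vertex set \<times> vertex set) measure) S T.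
           prob_space \<Omega> \<and> random_tree_with_law \<Omega> S (uniform_tree k) \<and>
           random_tree_with_law \<Omega> T infinite_tree_half \<and> \<P>(\<omega> in \<Omega>. S \<omega> \<subseteq> T \<omega>) = 1"
proof -
  have "\<exists>\<mu> (\<Omega> :: (nat \<Rightarrow> vertex set) measure) T. increasing_coupling \<Omega> T \<and>
      \<mu> = distr \<Omega> tree_space (\<lambda>\<omega>. \<Union>k\<in>{1..}. T k \<omega>)"
    using increasing_coupling_exists by blast
  from someI_ex[OF this] obtain \<Omega> :: "(nat \<Rightarrow> vertex set) measure" and T where
    T: "increasing_coupling \<Omega> T" and half: "infinite_tree_half = distr \<Omega> tree_space (\<lambda>\<omega>. \<Union>k\<in>{1..}. T k \<omega>)"
    unfolding infinite_tree_half_def by blast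
  have T_meas: "T k \<in> measurable \<Omega> tree_space" if "1 \<le> k" for k
    using T that by (auto simp: increasing_coupling_def random_tree_with_law_def)
  have "(\<lambda>\<omega>. \<Union>k\<in>{1..}. T k \<omega>) \<in> measurable \<Omega> tree_space"
  proof (rule measurable_tree_spaceI)
    show "(\<Union>k\<in>{1..}. T k \<omega>) \<subseteq> verts" if "\<omega> \<in> space \<Omega>" for \<omega>
      using measurable_space[OF T_meas that] by auto
    fix v assume v: "v \<in> verts"
    have "Measurable.pred \<Omega> (\<lambda>\<omega>. \<exists>k\<in>{1..}. v \<in> T k \<omega>)"
      by (intro pred_intros_countable_bounded) (auto intro!: measurable_compose[OF T_meas pred_mem_tree_space[OF v]])
    then show "Measurable.pred \<Omega> (\<lambda>\<omega>. v \<in> (\<Union>k\<in>{1..}. T k \<omega>))" by simp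
  qed
  then have "random_tree_with_law \<Omega> (\<lambda>\<omega>. \<Union>k\<in>{1..}. T k \<omega>) infinite_tree_half"
    by (simp add: random_tree_with_law_def half)
  moreover have "random_tree_with_law \<Omega> (T k) (uniform_tree k)" "prob_space \<Omega>"
    using T assms by (auto simp: increasing_coupling_def)
  ultimately show ?thesis
    using assms by (intro coupling_on_pairs[of \<Omega> "T k"]) auto
qed

text \<open>The law of the truncation is read off from \<open>gw_trunc_infinite\<close> after division by the probability
  \<open>(2 p - 1) / p\<close> of the conditioning event. This probability is the case \<open>h = 0\<close> of the same lemma, in which every
  truncation is \<open>Lf\<close>.\<close>

lemma conditioned_tree:
  assumes p: "1/2 < p" "p \<le> 1"
  shows "prob_space (infinite_tree p)"
    and "measure (infinite_tree p) {T \<in> space (infinite_tree p). trunc h (T - {[]}) = t}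
      = pmf (tree_pmf (size_split p) h \<infinity>) t"
    and "AE T in infinite_tree p. [] \<in> T"
    and "sets (infinite_tree p) = sets tree_space"
proof -
  interpret N: prob_space "gw_space p" by (rule prob_space_gw_space)
  interpret G: prob_space "gw_law p"
    unfolding gw_law_def by (rule N.prob_space_distr[OF gw_tree_measurable])
  define I where "I = {T \<in> space tree_space. infinite T}"
  have law: "infinite_tree p = uniform_measure (gw_law p) I" using p by (simp add: infinite_tree_def I_def)
  have I_sets: "I \<in> sets (gw_law p)" using infinite_trees_measurable by (simp add: I_def gw_law_def)
  have gw: "measure (gw_law p) A = measure (gw_space p) {X \<in> space (gw_space p). gw_tree X \<in> A}"
    if "A \<in> sets tree_space" for A
    unfolding gw_law_def using that
    by (subst measure_distr[OF gw_tree_measurable]) (auto intro!: arg_cong[where f = "measure _"])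
  have gw_verts: "gw_tree X \<subseteq> verts" for X by (auto simp: mem_gw_tree_iff)
  define B where "B h t = {T \<in> space tree_space. trunc h (T - {[]}) = t}" for h t
  have B_sets: "B h t \<in> sets tree_space" for h t
    using measurable_sets[OF trunc_measurable, of "{t}" h]
    by (simp add: B_def vimage_def Int_def conj_commute)
  have IB: "measure (gw_law p) (I \<inter> B h t) = (2 * p - 1) / p * pmf (tree_pmf (size_split p) h \<infinity>) t" for h t
  proof -
    have "I \<inter> B h t \<in> sets tree_space" using infinite_trees_measurable B_sets[of h t] by (simp add: I_def)
    moreover have "{X \<in> space (gw_space p). gw_tree X \<in> I \<inter> B h t}
        = {X \<in> space (gw_space p). gw_trunc h X = t \<and> infinite (gw_tree X)}"
      using gw_verts by (auto simp: I_def B_def gw_trunc_def)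
    ultimately show ?thesis by (simp only: gw gw_trunc_infinite[OF p])
  qed
  have "I \<inter> B 0 Lf = I" by (auto simp: I_def B_def)
  then have I: "measure (gw_law p) I = (2 * p - 1) / p" using IB[of 0 Lf] by simp
  have pos: "0 < (2 * p - 1) / p" using p by simp
  have nz: "emeasure (gw_law p) I \<noteq> 0" "emeasure (gw_law p) I \<noteq> \<infinity>"
    using p by (simp_all add: G.emeasure_eq_measure I)
  show "prob_space (infinite_tree p)" unfolding law by (rule prob_space_uniform_measure[OF nz])
  show sets: "sets (infinite_tree p) = sets tree_space" by (simp add: law gw_law_def)
  have "{T \<in> space (infinite_tree p). trunc h (T - {[]}) = t} = B h t"
    using sets_eq_imp_space_eq[OF sets] by (simp add: B_def)
  then show "measure (infinite_tree p) {T \<in> space (infinite_tree p). trunc h (T - {[]}) = t}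
      = pmf (tree_pmf (size_split p) h \<infinity>) t"
    using p B_sets[of h t] by (simp add: law nz gw_law_def[of p, THEN arg_cong[where f = sets]] IB I)
  have "Measurable.pred tree_space (\<lambda>T. [] \<in> T)" by (rule pred_mem_tree_space) (simp add: verts_def)
  then have "AE T in gw_law p. [] \<in> T"
    unfolding gw_law_def
    by (subst AE_distr_iff[OF gw_tree_measurable]) (auto simp: pred_def mem_gw_tree_iff verts_def)
  then show "AE T in infinite_tree p. [] \<in> T"
    unfolding law by (intro AE_uniform_measureI[OF I_sets]) auto
qed

text \<open>Trees with \<open>n\<close> nodes have height at most \<open>n\<close>, so a coupling of the uniform tree with the truncation
  of the infinite tree at height \<open>n\<close> is enough.\<close>

lemma coupling_above_half:
  assumes p: "1/2 < p" "p \<le> 1"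
  shows "\<exists>(\<Omega> :: (vertex set \<times> vertex set) measure) S T.
           prob_space \<Omega> \<and> random_tree_with_law \<Omega> S (uniform_tree (Suc n)) \<and>
           random_tree_with_law \<Omega> T (infinite_tree p) \<and> \<P>(\<omega> in \<Omega>. S \<omega> \<subseteq> T \<omega>) = 1"
proof -
  let ?M = "infinite_tree p"
  note M = conditioned_tree[OF p]
  interpret M: prob_space ?M by (rule M(1))
  have f: "(\<lambda>T. trunc n (T - {[]})) \<in> measurable ?M (count_space UNIV)"
    using trunc_measurable[of n] by (simp add: measurable_cong_sets[OF M(4) refl])
  have rel: "rel_pmf (\<le>) (tree_pmf (size_split p) n (enat n)) (tree_pmf (size_split p) n \<infinity>)"
    by (intro tree_pmf_mono size_split_mono p) auto
  obtain N :: "(bintree \<Rightarrow> bintree) measure" and Z where N: "prob_space N"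
    and Z: "Z \<in> measurable (?M \<Otimes>\<^sub>M N) (count_space UNIV)"
    and Z_law: "distr (?M \<Otimes>\<^sub>M N) (count_space UNIV) Z = measure_pmf (tree_pmf (size_split p) n (enat n))"
    and Z_le: "AE z in ?M \<Otimes>\<^sub>M N. Z z \<le> trunc n (fst z - {[]})"
    by (rule rel_pmf_extend_space[OF M(1) f M(2) rel])
  interpret N: prob_space N by (rule N)
  interpret MN: pair_prob_space ?M N ..
  have fst_distr: "distr (?M \<Otimes>\<^sub>M N) ?M fst = ?M" by (rule N.distr_pair_fst)
  have "random_tree_with_law (?M \<Otimes>\<^sub>M N) fst ?M"
    unfolding random_tree_with_law_def
  proof
    show "fst \<in> measurable (?M \<Otimes>\<^sub>M N) tree_space"
      using measurable_fst[of ?M N] by (simp add: measurable_cong_sets[OF refl M(4)])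
    show "distr (?M \<Otimes>\<^sub>M N) tree_space fst = ?M"
      using fst_distr by (simp add: distr_cong[OF refl M(4)[symmetric] refl])
  qed
  moreover have "random_tree_with_law (?M \<Otimes>\<^sub>M N) (\<lambda>z. ordered_tree_of (Z z)) (uniform_tree (Suc n))"
    by (rule random_tree_with_uniform_law[OF Z Z_law]) simp
  moreover have "AE z in ?M \<Otimes>\<^sub>M N. ordered_tree_of (Z z) \<subseteq> fst z"
  proof -
    have "AE z in ?M \<Otimes>\<^sub>M N. [] \<in> fst z"
      using M(3) by (intro AE_distrD[of fst "?M \<Otimes>\<^sub>M N" ?M "\<lambda>T. [] \<in> T"]) (simp_all only: fst_distr measurable_fst)
    with Z_le show ?thesis
    proof eventually_elim
      fix z assume "Z z \<le> trunc n (fst z - {[]})" "[] \<in> fst z"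
      then show "ordered_tree_of (Z z) \<subseteq> fst z"
        using nonroot_subset_nonroot_iff[of "Z z" "trunc n (fst z - {[]})"] nonroot_trunc_subset[of n "fst z - {[]}"]
        by (auto simp: ordered_tree_of_def)
    qed
  qed
  ultimately show ?thesis by (intro coupling_on_pairs[of "?M \<Otimes>\<^sub>M N"] MN.prob_space_axioms)
qed

theorem corollary1p3:
  fixes k :: nat and p :: real
  assumes "1 \<le> k" and "1/2 \<le> p" and "p \<le> 1"
  shows "\<exists>(\<Omega> :: (vertex set \<times> vertex set) measure) T\<^sub>k T'.
           prob_space \<Omega> \<and>
           random_tree_with_law \<Omega> T\<^sub>k (uniform_tree k) \<and>
           random_tree_with_law \<Omega> T' (infinite_tree p) \<and>
           \<P>(\<omega> in \<Omega>. T\<^sub>k \<omega> \<subseteq> T' \<omega>) = 1"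
proof (cases "p = 1/2")
  case True
  then have "infinite_tree p = infinite_tree_half" by (simp add: infinite_tree_def)
  then show ?thesis using coupling_at_half[OF \<open>1 \<le> k\<close>] by simp
next
  case False
  with assms have "1/2 < p" by simp
  moreover obtain n where "k = Suc n" using \<open>1 \<le> k\<close> by (cases k) auto
  ultimately show ?thesis using coupling_above_half[of p n] \<open>p \<le> 1\<close> by simp
qed

end
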